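(* Let $\Lambda\subset[0,1]^d$ be a non-degenerated Lalley-Gatzouras type sponge, and let $\mu$ be its canonical Bernoulli measure. If $\Lambda$ does not satisfy the maximal power law, then there exists a real number $0<\chi<\dim_B\Lambda$ such that for any cylinder $R$ of $\Lambda$, $$h_R(\delta)=O\big(\mu(R)\,\delta^{-\chi}\big),\qquad \delta\to0.$$
   Context: Diagonal self-affine sponges. Let $d\ge1$. For each $i\in\{1,\dots,d\}$ let $A_i=\{0,1,\dots,n_i-1\}$ with $n_i\ge2$, and let $(\phi_{a,i})_{a\in A_i}$ be contracting similarities of $[0,1]$ into itself with positive ratios ($\phi_{a,i}(x)=rx+t$, $0<r<1$; $\phi_{a,i}'$ denotes the constant $r$). Let $A=\prod_{i=1}^d A_i$; for $a=(a_1,\dots,a_d)\in A$ let $\phi_a(x_1,\dots,x_d)=(\phi_{a,1}(x_1),\dots,\phi_{a,d}(x_d))$, where $\phi_{a,i}$ is shorthand for $\phi_{a_i,i}$. For nonempty $\mathcal{D}\subset A$, $\Phi=(\phi_a)_{a\in\mathcal{D}}$ (all maps distinct) is a diagonal IFS and its attractor $\Lambda$ (the unique nonempty compact set with $\Lambda=\bigcup_{a\in\mathcal D}\phi_a(\Lambda)$) is a diagonal self-affine sponge. For $1\le j\le d$ let $\pi_j(x_1,\dots,x_d)=(x_1,\dots,x_j)$ and $\Phi_{\{1,\dots,j\}}=\big((\phi_{a,1},\dots,\phi_{a,j})\big)_{a\in\pi_j(\mathcal{D})}$, an IFS on $\mathbb{R}^j$. $\Lambda$ is of Lalley-Gatzouras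 type if (coordinate ordering condition) $\phi'_{a,1}>\dots>\phi'_{a,d}$ for all $a\in\mathcal{D}$, and (neat projection condition) for each $j\in\{1,\dots,d\}$ the images of $(0,1)^j$ under the maps of $\Phi_{\{1,\dots,j\}}$, indexed by $\pi_j(\mathcal{D})$, are pairwise disjoint. $\Lambda$ is non-degenerated if it is not contained in a $(d-1)$-dimensional face of $[0,1]^d$. Canonical Bernoulli measure. Define $\beta_1,\dots,\beta_d$ inductively: $\beta_j$ is the unique real number with $\sum_{(f_1,\dots,f_j)\in\Phi_{\{1,\dots,j\}}}\prod_{k=1}^j(f_k')^{\beta_k}=1$. The canonical Bernoulli measure $\mu$ of $\Lambda$ is the unique Borel probability measure with $\mu(\cdot)=\sum_{\mathbf f\in\Phi}p_{\mathbf f}\,\mu(\mathbf f^{-1}(\cdot))$, where $p_{\mathbf f}=\prod_{k=1}^d(f_k')^{\beta_k}$ for $\mathbf f=(f_1,\dots,f_d)$. Cylinders of $\Lambda$: sets $\phi_{i_1}\circ\dots\circ\phi_{i_n}(\Lambda)$, $n\ge0$, $i_1,\dots,i_n\in\mathcal{D}$. Counting components. For a metric space $(E,\rho)$ and $\delta>0$, $x,y\in E$ are $\delta$-equivalent if there is a finite sequence $x=x_1,\dots,x_k=y$ in $E$ with $\rho(x_i,x_{i+1})\le\delta$ for all $i$; the equivalence classes are the $\delta$-connected components and $h_E(\delta)$ is their number. A compact $E$ satisfies the maximal power law if $h_E(\delta)\asymp\delta^{-\dim_B E}$ as $\delta\to0$, i.e. the two sides are within a constant multiplicative factor of each other for all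 small $\delta>0$ ($\dim_B$ is box dimension). *)

theory Defs
  imports "HOL-Probability.Probability_Measure" "HOL-Library.Landau_Symbols"
begin

section \<open>Diagonal iterated function systems\<close>

text \<open>
  The coordinates $1,\dots,d$ are the elements of a finite linearly ordered type \<open>'n\<close>, so that
  $d = $ \<open>CARD('n)\<close> \<open>\<ge> 1\<close> is arbitrary and the order of \<open>'n\<close> is the order of the coordinates.
  The data are \<open>n i\<close> (the number of maps in coordinate \<open>i\<close>), the ratios \<open>r i c\<close> and translations
  \<open>t i c\<close> of the maps $\phi_{c,i}(x) = r\,x + t$ for \<open>c < n i\<close>, and the digit set \<open>D\<close>; a digit
  \<open>a\<close> is the family of its coordinates \<open>a i\<close>.
\<close>

definition digits :: "('n::{finite,linorder} \<Rightarrow> nat) \<Rightarrow> ('n \<Rightarrow> nat) set" where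
  "digits n = {a. \<forall>i. a i \<in> {..<n i}}"

definition coord_map ::
  "('n::{finite,linorder} \<Rightarrow> nat \<Rightarrow> real) \<Rightarrow> ('n \<Rightarrow> nat \<Rightarrow> real) \<Rightarrow> 'n \<Rightarrow> nat \<Rightarrow> real \<Rightarrow> real" where
  "coord_map r t i c x = r i c * x + t i c"

definition diag_map ::
  "('n::{finite,linorder} \<Rightarrow> nat \<Rightarrow> real) \<Rightarrow> ('n \<Rightarrow> nat \<Rightarrow> real) \<Rightarrow> ('n \<Rightarrow> nat) \<Rightarrow> (real, 'n) vec \<Rightarrow> (real, 'n) vec" where
  "diag_map r t a x = (\<chi> i. coord_map r t i (a i) (x $ i))"

definition diagonal_ifs ::
  "('n::{finite,linorder} \<Rightarrow> nat) \<Rightarrow> ('n \<Rightarrow> nat \<Rightarrow> real) \<Rightarrow> ('n \<Rightarrow> nat \<Rightarrow> real) \<Rightarrow> ('n \<Rightarrow> nat) set \<Rightarrow> bool" where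
  "diagonal_ifs n r t D \<longleftrightarrow>
     (\<forall>i. n i \<ge> 2) \<and>
     (\<forall>i. \<forall>c<n i. 0 < r i c \<and> r i c < 1 \<and> coord_map r t i c ` {0..1} \<subseteq> {0..1}) \<and>
     D \<noteq> {} \<and> D \<subseteq> digits n \<and> inj_on (diag_map r t) D"

definition attractor ::
  "('n::{finite,linorder} \<Rightarrow> nat \<Rightarrow> real) \<Rightarrow> ('n \<Rightarrow> nat \<Rightarrow> real) \<Rightarrow> ('n \<Rightarrow> nat) set \<Rightarrow> (real, 'n) vec set \<Rightarrow> bool" where
  "attractor r t D \<Lambda> \<longleftrightarrow> compact \<Lambda> \<and> \<Lambda> \<noteq> {} \<and> \<Lambda> = (\<Union>a\<in>D. diag_map r t a ` \<Lambda>)"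


section \<open>Projections and the Lalley-Gatzouras condition\<close>

text \<open>
  Real vectors and digits with only the coordinates $1,\dots,j$ are extensional functions on \<open>{..j}\<close>.
\<close>

definition proj_coords :: "'n::{finite,linorder} \<Rightarrow> ('n \<Rightarrow> 'b) \<Rightarrow> ('n \<Rightarrow> 'b)" where
  "proj_coords j a = restrict a {..j}"

definition proj_map ::
  "('n::{finite,linorder} \<Rightarrow> nat \<Rightarrow> real) \<Rightarrow> ('n \<Rightarrow> nat \<Rightarrow> real) \<Rightarrow> 'n \<Rightarrow> ('n \<Rightarrow> nat) \<Rightarrow> ('n \<Rightarrow> real) \<Rightarrow> ('n \<Rightarrow> real)" where
  "proj_map r t j b y = (\<lambda>k\<in>{..j}. coord_map r t k (b k) (y k))"

definition coordinate_ordering ::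
  "('n::{finite,linorder} \<Rightarrow> nat \<Rightarrow> real) \<Rightarrow> ('n \<Rightarrow> nat) set \<Rightarrow> bool" where
  "coordinate_ordering r D \<longleftrightarrow> (\<forall>a\<in>D. \<forall>i j. i < j \<longrightarrow> r i (a i) > r j (a j))"

definition neat_projection ::
  "('n::{finite,linorder} \<Rightarrow> nat \<Rightarrow> real) \<Rightarrow> ('n \<Rightarrow> nat \<Rightarrow> real) \<Rightarrow> ('n \<Rightarrow> nat) set \<Rightarrow> bool" where
  "neat_projection r t D \<longleftrightarrow>
     (\<forall>j. disjoint_family_on (\<lambda>b. proj_map r t j b ` ({..j} \<rightarrow>\<^sub>E {0<..<1})) (proj_coords j ` D))"

definition lalley_gatzouras_sponge ::
  "('n::{finite,linorder} \<Rightarrow> nat) \<Rightarrow> ('n \<Rightarrow> nat \<Rightarrow> real) \<Rightarrow> ('n \<Rightarrow> nat \<Rightarrow> real) \<Rightarrow> ('n \<Rightarrow> nat) set \<Rightarrow> (real, 'n) vec set \<Rightarrow> bool" where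
  "lalley_gatzouras_sponge n r t D \<Lambda> \<longleftrightarrow>
     diagonal_ifs n r t D \<and> attractor r t D \<Lambda> \<and> coordinate_ordering r D \<and> neat_projection r t D"

definition non_degenerated :: "(real, 'n::finite) vec set \<Rightarrow> bool" where
  "non_degenerated \<Lambda> \<longleftrightarrow> \<not> (\<exists>F. F facet_of (cbox 0 One :: (real, 'n) vec set) \<and> \<Lambda> \<subseteq> F)"

definition cylinders ::
  "('n::{finite,linorder} \<Rightarrow> nat \<Rightarrow> real) \<Rightarrow> ('n \<Rightarrow> nat \<Rightarrow> real) \<Rightarrow> ('n \<Rightarrow> nat) set \<Rightarrow> (real, 'n) vec set \<Rightarrow> (real, 'n) vec set set" where
  "cylinders r t D \<Lambda> = {foldr (\<lambda>a f. diag_map r t a \<circ> f) w id ` \<Lambda> | w. set w \<subseteq> D}"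


section \<open>The canonical Bernoulli measure\<close>

text \<open>
  The equation for \<open>j\<close> only involves \<open>\<beta> k\<close> for \<open>k \<le> j\<close> and determines \<open>\<beta> j\<close> from the earlier
  exponents. Under the neat projection condition distinct elements of \<open>proj_coords j ` D\<close> give distinct
  maps, so summing over these indices is summing over the maps of the projected system.
\<close>

definition canonical_exponents ::
  "('n::{finite,linorder} \<Rightarrow> nat \<Rightarrow> real) \<Rightarrow> ('n \<Rightarrow> nat) set \<Rightarrow> ('n \<Rightarrow> real) \<Rightarrow> bool" where
  "canonical_exponents r D \<beta> \<longleftrightarrow>
     (\<forall>j. (\<Sum>b\<in>proj_coords j ` D. \<Prod>k\<in>{..j}. r k (b k) powr \<beta> k) = 1)"

definition canonical_bernoulli_measure ::
  "('n::{finite,linorder} \<Rightarrow> nat \<Rightarrow> real) \<Rightarrow> ('n \<Rightarrow> nat \<Rightarrow> real) \<Rightarrow> ('n \<Rightarrow> nat) set \<Rightarrow> (real, 'n) vec measure \<Rightarrow> bool" where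
  "canonical_bernoulli_measure r t D \<mu> \<longleftrightarrow>
     prob_space \<mu> \<and> sets \<mu> = sets borel \<and>
     (\<exists>\<beta>. canonical_exponents r D \<beta> \<and>
       (\<forall>B\<in>sets borel.
          measure \<mu> B = (\<Sum>a\<in>D. (\<Prod>k\<in>UNIV. r k (a k) powr \<beta> k) * measure \<mu> (diag_map r t a -` B))))"


section \<open>Box dimension and counting of components\<close>

definition covering_number :: "'a::metric_space set \<Rightarrow> real \<Rightarrow> nat" where
  "covering_number E \<delta> = (LEAST m. \<exists>C. finite C \<and> card C = m \<and> E \<subseteq> (\<Union>c\<in>C. cball c \<delta>))"

text \<open>The value is meaningful for bounded sets for which the limit exists.\<close>

definition box_dim :: "'a::metric_space set \<Rightarrow> real" where
  "box_dim E = Lim (at_right 0) (\<lambda>\<delta>. ln (real (covering_number E \<delta>)) / - ln \<delta>)"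

definition chain_step :: "'a::metric_space set \<Rightarrow> real \<Rightarrow> ('a \<times> 'a) set" where
  "chain_step E \<delta> = {(x, y). x \<in> E \<and> y \<in> E \<and> dist x y \<le> \<delta>}"

text \<open>The number of components is finite when \<open>E\<close> is compact and \<open>\<delta> > 0\<close>.\<close>

definition num_components :: "'a::metric_space set \<Rightarrow> real \<Rightarrow> nat" where
  "num_components E \<delta> = card (E // (chain_step E \<delta>)\<^sup>*)"

definition maximal_power_law :: "'a::metric_space set \<Rightarrow> bool" where
  "maximal_power_law E \<longleftrightarrow>
     (\<lambda>\<delta>. real (num_components E \<delta>)) \<in> \<Theta>[at_right 0](\<lambda>\<delta>. \<delta> powr (- box_dim E))"

end

theory Submission
  imports Defs "HOL-Real_Asymp.Real_Asymp"
begin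

text \<open>
  Write $s = \beta_1 + \dots + \beta_d$. Cutting $\Lambda$ into approximate cubes of side $\delta$
  (words that are prolonged in the coordinates $1,\dots,k$ until the $k$-th side drops below $\delta$,
  for $k = d, \dots, 1$) gives about $\delta^{-s}$ pieces, because the weights
  $\prod_{k \le j} (f_k')^{\beta_k}$ add up to $1$ at each stage. Hence the covering number of $\Lambda$ and the
  number of its $\delta$-components are $O(\delta^{-s})$.

  Call a part of $\pi_j(\Lambda)$ an island if it lies in the open cube $(0,1)^j$, away from the boundary and
  at positive distance from the rest of $\pi_j(\Lambda)$.

  If every projection $\pi_j(\Lambda)$ has an island, then inserting an island whenever a coordinate is
  abandoned turns the approximate cubes into about $\delta^{-s}$ pieces of $\Lambda$ each of which is
  at distance at least $c\delta$ from the rest, so $\Lambda$ satisfies the maximal power law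
  (\<open>maximal_power_law_of_islands\<close>). The same construction, with a cylinder inside the open cube in place of
  an island, yields points that are $c\delta$ apart and thereby the lower bound in \<open>box_dim \<Lambda> = s\<close>
  (\<open>box_dim_sponge\<close>).

  If some $\pi_j(\Lambda)$ has no island, then each of its $\delta$-components reaches the boundary of the
  cube (\<open>chain_to_boundary\<close>), so only pieces along the faces have to be counted. By non-degeneracy a
  face is generated by a proper subset of the digits, which lowers the exponent of the $j$-th side by some
  $\epsilon > 0$ (\<open>chain_growth_without_island\<close>). If $j < d$, this only applies to what is left after
  coordinate $j + 1$ has been abandoned, but at that moment the strict ordering of the ratios makes side $j$
  longer than $\delta$ by a power of $1/\delta$. Hence there is a gain in the total exponent
  (\<open>smaller_exponent_without_island\<close>). So the number of components of $\Lambda$ is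
  $O(\delta^{-\theta})$ with $\theta < s$.

  Cylinders are contracted copies of $\Lambda$ and therefore have no more components than $\Lambda$. As
  $\mu(R) > 0$, an exponent strictly between $\theta$ and $s$ absorbs the factor $\mu(R)$ for small $\delta$.
\<close>

section \<open>Elementary estimates\<close>

lemma powr_unit_bounds:
  fixes x g :: real
  assumes "0 < L" "L \<le> x" "x \<le> 1"
  shows "min 1 (L powr g) \<le> x powr g" "x powr g \<le> max 1 (L powr g)"
proof -
  have "1 \<le> x powr g \<and> x powr g \<le> L powr g \<or> L powr g \<le> x powr g \<and> x powr g \<le> 1"
  proof (cases "0 \<le> g")
    case True
    then have "L powr g \<le> x powr g \<and> x powr g \<le> 1 powr g"
      using assms by (intro conjI powr_mono2) auto
    then show ?thesis by simp
  next
    case False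
    then have "1 powr g \<le> x powr g \<and> x powr g \<le> L powr g"
      using assms by (intro conjI powr_mono2') auto
    then show ?thesis by simp
  qed
  then show "min 1 (L powr g) \<le> x powr g" "x powr g \<le> max 1 (L powr g)" by auto
qed

lemma card_Union_images_le:
  assumes "finite B" "\<And>a. a \<in> B \<Longrightarrow> finite (P a) \<and> real (card (P a)) \<le> m a"
  shows "finite (\<Union>a\<in>B. f a ` P a)" "real (card (\<Union>a\<in>B. f a ` P a)) \<le> (\<Sum>a\<in>B. m a)"
proof -
  show "finite (\<Union>a\<in>B. f a ` P a)" using assms by auto
  have "card (\<Union>a\<in>B. f a ` P a) \<le> (\<Sum>a\<in>B. card (f a ` P a))"
    using assms by (intro card_UN_le)
  also have "\<dots> \<le> (\<Sum>a\<in>B. card (P a))"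
    using assms by (intro sum_mono card_image_le) auto
  finally have "real (card (\<Union>a\<in>B. f a ` P a)) \<le> (\<Sum>a\<in>B. real (card (P a)))"
    by (metis of_nat_le_iff of_nat_sum)
  also have "\<dots> \<le> (\<Sum>a\<in>B. m a)" using assms by (intro sum_mono) auto
  finally show "real (card (\<Union>a\<in>B. f a ` P a)) \<le> (\<Sum>a\<in>B. m a)" .
qed

lemma open_intervals_meet:
  fixes p q \<rho> s y :: real
  assumes "p < y" "y < p + \<rho>" "q \<le> y" "y \<le> q + s" "0 < s"
  obtains z where "p < z" "z < p + \<rho>" "q < z" "z < q + s"
proof -
  have "max p q < min (p + \<rho>) (q + s)" using assms by auto
  then obtain z where "max p q < z" "z < min (p + \<rho>) (q + s)" using dense by blast
  then show ?thesis using that by auto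
qed

lemma divide_powr:
  fixes x y s :: real
  assumes "0 < x" "0 < y"
  shows "(x / y) powr s = x powr s * y powr (- s)"
  using assms by (simp add: powr_divide powr_minus_divide)

lemma tendsto_mult_powr_right_zero:
  fixes p C :: real
  assumes "0 < p" shows "((\<lambda>\<delta>. C * \<delta> powr p) \<longlongrightarrow> 0) (at_right 0)"
  using assms by real_asymp

lemma eventually_small: "0 < c \<Longrightarrow> \<forall>\<^sub>F \<delta> in at_right (0::real). 0 < \<delta> \<and> \<delta> < c"
  using eventually_at_right_real[of 0 c] by simp

section \<open>Components and covering numbers\<close>

lemma sym_chain_steps: "sym ((chain_step E \<delta>)\<^sup>*)"
  by (intro sym_rtrancl) (auto simp: sym_def chain_step_def dist_commute)

lemma components_le_chain_net:
  assumes "finite P" "\<And>x. x \<in> E \<Longrightarrow> \<exists>p\<in>P. (x, p) \<in> (chain_step E \<delta>)\<^sup>*"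
  shows "finite (E // (chain_step E \<delta>)\<^sup>*)" "num_components E \<delta> \<le> card P"
proof -
  let ?R = "(chain_step E \<delta>)\<^sup>*"
  have "E // ?R \<subseteq> (\<lambda>p. ?R `` {p}) ` P"
  proof
    fix X assume "X \<in> E // ?R"
    then obtain x where x: "x \<in> E" "X = ?R `` {x}" by (auto simp: quotient_def)
    obtain p where p: "p \<in> P" "(x, p) \<in> ?R" using assms(2)[OF x(1)] by blast
    have "(p, x) \<in> ?R" using sym_chain_steps p(2) by (rule symD)
    then have "?R `` {x} = ?R `` {p}" using p(2) by (auto intro: rtrancl_trans)
    then show "X \<in> (\<lambda>p. ?R `` {p}) ` P" using x p by blast
  qed
  then show "finite (E // ?R)" "num_components E \<delta> \<le> card P"
    unfolding num_components_def using assms(1)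
    by (auto intro: finite_subset surj_card_le)
qed

text \<open>
  A component that starts in a piece cannot leave it, so the pieces contain different components. The
  finiteness hypothesis rules out the value \<open>0\<close> that \<open>card\<close> takes on infinite sets.
\<close>
lemma components_ge_separated_pieces:
  assumes fin: "finite (E // (chain_step E \<delta>)\<^sup>*)" and disj: "disjoint \<V>"
    and V: "\<And>V. V \<in> \<V> \<Longrightarrow> V \<noteq> {} \<and> V \<subseteq> E"
    and sep: "\<And>V x y. V \<in> \<V> \<Longrightarrow> x \<in> V \<Longrightarrow> y \<in> E - V \<Longrightarrow> \<delta> < dist x y"
  shows "card \<V> \<le> num_components E \<delta>"
proof -
  let ?R = "(chain_step E \<delta>)\<^sup>*"
  obtain p where p: "\<And>V. V \<in> \<V> \<Longrightarrow> p V \<in> V" using V by (metis ex_in_conv)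
  have cls: "?R `` {p V} \<subseteq> V" if "V \<in> \<V>" for V
  proof -
    have "y \<in> V" if "(p V, y) \<in> ?R" for y
      using that
    proof (induction rule: rtrancl_induct)
      case base then show ?case using p \<open>V \<in> \<V>\<close> by blast
    next
      case (step y z)
      then show ?case using sep[OF \<open>V \<in> \<V>\<close>, of y z] by (force simp: chain_step_def)
    qed
    then show ?thesis by blast
  qed
  have "inj_on (\<lambda>V. ?R `` {p V}) \<V>"
  proof (rule inj_onI)
    fix V W assume VW: "V \<in> \<V>" "W \<in> \<V>" and eq: "?R `` {p V} = ?R `` {p W}"
    have "p V \<in> ?R `` {p V}" by simp
    then have "p V \<in> V \<inter> W" using cls VW p eq by blast
    then show "V = W" using disj VW by (meson disjnt_iff IntD1 IntD2 pairwiseD)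
  qed
  moreover have "(\<lambda>V. ?R `` {p V}) ` \<V> \<subseteq> E // ?R"
    using p V by (auto intro!: quotientI)
  ultimately show ?thesis
    unfolding num_components_def using fin by (meson card_inj_on_le)
qed

lemma chain_image:
  assumes f: "\<And>x y. x \<in> E \<Longrightarrow> y \<in> E \<Longrightarrow> dist (f x) (f y) \<le> dist x y"
    and "(x, y) \<in> (chain_step E \<delta>)\<^sup>*"
  shows "(f x, f y) \<in> (chain_step (f ` E) \<delta>)\<^sup>*"
  using assms(2)
proof (induction rule: rtrancl_induct)
  case (step y z)
  then have "(f y, f z) \<in> chain_step (f ` E) \<delta>"
    using f[of y z] by (auto simp: chain_step_def)
  then show ?case using step.IH by (rule rtrancl_into_rtrancl[rotated])
qed simp

lemma covering_number_le:
  assumes "finite P" "\<And>x. x \<in> E \<Longrightarrow> \<exists>p\<in>P. dist x p \<le> \<delta>"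
  shows "covering_number E \<delta> \<le> card P"
  unfolding covering_number_def
  using assms by (intro Least_le exI[of _ P]) (auto simp: dist_commute)

text \<open>
  A ball of the covering contains at most one point of a set that is more than \<open>2 * \<delta>\<close>-separated. The
  finite \<open>\<delta>\<close>-net guarantees that the minimum in the definition of the covering number is attained.
\<close>
lemma covering_number_ge:
  assumes P: "finite P" "\<And>x. x \<in> E \<Longrightarrow> \<exists>p\<in>P. dist x p \<le> \<delta>"
    and X: "X \<subseteq> E" "\<And>x y. x \<in> X \<Longrightarrow> y \<in> X \<Longrightarrow> x \<noteq> y \<Longrightarrow> 2 * \<delta> < dist x y"
  shows "card X \<le> covering_number E \<delta>"
proof -
  let ?Q = "\<lambda>m. \<exists>C. finite C \<and> card C = m \<and> E \<subseteq> (\<Union>c\<in>C. cball c \<delta>)"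
  have "?Q (card P)" using P by (intro exI[of _ P]) (auto simp: dist_commute)
  then have "?Q (covering_number E \<delta>)" unfolding covering_number_def by (rule LeastI)
  then obtain C where C: "finite C" "card C = covering_number E \<delta>" "E \<subseteq> (\<Union>c\<in>C. cball c \<delta>)" by blast
  have "\<forall>x\<in>X. \<exists>c\<in>C. dist x c \<le> \<delta>" using C(3) X(1) by (force simp: dist_commute)
  then obtain q where q: "\<And>x. x \<in> X \<Longrightarrow> q x \<in> C \<and> dist x (q x) \<le> \<delta>" by metis
  have "inj_on q X"
  proof (rule inj_onI, rule ccontr)
    fix x y assume xy: "x \<in> X" "y \<in> X" "q x = q y" "x \<noteq> y"
    then have "dist x y \<le> \<delta> + \<delta>"
      using q[OF xy(1)] q[OF xy(2)] dist_triangle2[of x y "q x"] by simp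
    then show False using X(2)[OF xy(1,2,4)] by simp
  qed
  then show ?thesis using q C by (metis card_inj_on_le image_subsetI)
qed

lemma box_dim_eqI:
  fixes s c C :: real
  assumes c: "0 < c" "0 < C"
    and lower: "\<forall>\<^sub>F \<delta> in at_right 0. c * \<delta> powr (- s) \<le> real (covering_number E \<delta>)"
    and upper: "\<forall>\<^sub>F \<delta> in at_right 0. real (covering_number E \<delta>) \<le> C * \<delta> powr (- s)"
  shows "box_dim E = s"
proof -
  let ?f = "\<lambda>\<delta>. ln (real (covering_number E \<delta>)) / - ln \<delta>"
  have bounds: "s + ln c / - ln \<delta> \<le> ?f \<delta> \<and> ?f \<delta> \<le> s + ln C / - ln \<delta>" 
    if \<delta>: "0 < \<delta>" "\<delta> < 1" and lo: "c * \<delta> powr (- s) \<le> real (covering_number E \<delta>)"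
      and up: "real (covering_number E \<delta>) \<le> C * \<delta> powr (- s)" for \<delta>
  proof -
    have l: "0 < - ln \<delta>" using \<delta> by simp
    have p: "0 < c * \<delta> powr (- s)" using c \<delta> by simp
    have "ln (c * \<delta> powr (- s)) \<le> ln (real (covering_number E \<delta>))"
      using lo p by (subst ln_le_cancel_iff) auto
    moreover have "ln (real (covering_number E \<delta>)) \<le> ln (C * \<delta> powr (- s))"
      using up lo p by (subst ln_le_cancel_iff) auto
    moreover have "ln (a * \<delta> powr (- s)) = ln a + s * - ln \<delta>" if "0 < a" for a
      using that \<delta> by (simp add: ln_mult ln_powr)
    ultimately have "ln c + s * - ln \<delta> \<le> ln (real (covering_number E \<delta>))"
      "ln (real (covering_number E \<delta>)) \<le> ln C + s * - ln \<delta>" using c by auto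
    moreover have "s + ln a / - ln \<delta> = (ln a + s * - ln \<delta>) / - ln \<delta>" for a
      using l by (simp add: field_simps)
    ultimately show ?thesis using l by (metis divide_right_mono less_imp_le)
  qed
  have ev: "\<forall>\<^sub>F \<delta> in at_right (0::real). 0 < \<delta> \<and> \<delta> < 1"
    using eventually_at_right_real[of 0 "1::real"] by simp
  have sandwich: "\<forall>\<^sub>F \<delta> in at_right 0. s + ln c / - ln \<delta> \<le> ?f \<delta> \<and> ?f \<delta> \<le> s + ln C / - ln \<delta>"
    using ev lower upper by eventually_elim (use bounds in blast)
  have lim: "((\<lambda>\<delta>. s + ln a / - ln \<delta>) \<longlongrightarrow> s) (at_right 0)" for a :: real
    by real_asymp
  have "(?f \<longlongrightarrow> s) (at_right 0)"
    by (rule tendsto_sandwich[OF _ _ lim[of c] lim[of C]])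
      (use sandwich in \<open>auto elim!: eventually_mono\<close>)
  then show ?thesis unfolding box_dim_def by (intro tendsto_Lim) auto
qed

section \<open>Faces of the cube\<close>

lemma One_nth: "(One :: (real, 'n::finite) vec) $ k = 1"
proof -
  have "(One :: (real, 'n) vec) \<bullet> axis k 1 = 1"
    by (simp add: inner_sum_left_Basis axis_in_Basis_iff del: sum_component)
  then show ?thesis by (simp add: inner_axis del: sum_component)
qed

lemma mem_unit_cube_iff: "x \<in> cbox 0 (One :: (real, 'n::finite) vec) \<longleftrightarrow> (\<forall>k. 0 \<le> x $ k \<and> x $ k \<le> 1)"
  by (simp add: mem_box_cart One_nth del: sum_component)

text \<open>
  The hyperplane is supporting, which makes the intersection a face. It contains a relatively open part of the
  hyperplane around the centre of the face, which gives the dimension.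
\<close>
lemma facet_of_unit_cube:
  fixes e :: real
  assumes "e \<in> {0, 1}"
  shows "{x \<in> cbox 0 (One :: (real, 'n::finite) vec). x $ k = e} facet_of cbox 0 One"
proof -
  let ?S = "cbox 0 (One :: (real, 'n) vec)" and ?H = "{x :: (real, 'n) vec. axis k 1 \<bullet> x = e}"
  have H: "axis k 1 \<bullet> x = x $ k" for x :: "(real, 'n) vec" by (simp add: inner_axis' )
  have F: "{x \<in> ?S. x $ k = e} = ?S \<inter> ?H" by (auto simp: H)
  have face: "?S \<inter> ?H face_of ?S"
  proof (cases "e = 0")
    case True
    then show ?thesis
      by (intro face_of_Int_supporting_hyperplane_ge) (auto simp: H mem_unit_cube_iff)
  next
    case False
    then show ?thesis using assms
      by (intro face_of_Int_supporting_hyperplane_le) (auto simp: H mem_unit_cube_iff)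
  qed
  have ax: "axis k (1::real) \<noteq> 0" by (simp add: axis_eq_0_iff)
  define p :: "(real, 'n) vec" where "p = (\<chi> i. if i = k then e else 1/2)"
  have sub: "?H \<inter> ball p (1/2) \<subseteq> ?S \<inter> ?H"
  proof
    fix x assume x: "x \<in> ?H \<inter> ball p (1/2)"
    have "0 \<le> x $ i \<and> x $ i \<le> 1" for i
    proof (cases "i = k")
      case True
      then show ?thesis using assms x by (auto simp: H)
    next
      case False
      have "\<bar>x $ i - p $ i\<bar> < 1/2"
        using component_le_norm_cart[of "x - p" i] x by (simp add: dist_norm norm_minus_commute)
      then have "\<bar>x $ i - 1/2\<bar> < 1/2" using False by (simp add: p_def)
      then show ?thesis by linarith
    qed
    then show "x \<in> ?S \<inter> ?H" using x by (auto simp: mem_unit_cube_iff)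
  qed
  have p: "p \<in> ?H \<inter> ball p (1/2)" by (simp add: H p_def)
  then have "affine hull (?H \<inter> ball p (1/2)) = affine hull ?H"
    by (intro affine_hull_affine_Int_open affine_hyperplane open_ball) blast
  then have "aff_dim (?H \<inter> ball p (1/2)) = aff_dim ?H"
    by (metis aff_dim_affine_hull)
  then have "aff_dim ?H \<le> aff_dim (?S \<inter> ?H)"
    using aff_dim_subset[OF sub] by simp
  moreover have "aff_dim (?S \<inter> ?H) \<le> aff_dim ?H" by (intro aff_dim_subset) auto
  moreover have "aff_dim ?H = int (DIM((real, 'n) vec)) - 1" using aff_dim_hyperplane[OF ax] by simp
  moreover have "aff_dim ?S = int (DIM((real, 'n) vec))"
  proof (rule aff_dim_nonempty_interior)
    have "(\<chi> i. 1/2) \<in> box 0 (One :: (real, 'n) vec)" by (simp add: mem_box_cart One_nth del: sum_component)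
    then show "interior ?S \<noteq> {}" by (auto simp: interior_cbox)
  qed
  moreover have "?S \<inter> ?H \<noteq> {}" using p sub by blast
  ultimately show ?thesis unfolding F facet_of_def using face by simp
qed

section \<open>Sponges as images of symbolic words\<close>

locale sponge =
  fixes n :: "'n::{finite,linorder} \<Rightarrow> nat"
    and r t :: "'n \<Rightarrow> nat \<Rightarrow> real"
    and D :: "('n \<Rightarrow> nat) set"
    and \<Lambda> :: "(real, 'n) vec set"
  assumes lg: "lalley_gatzouras_sponge n r t D \<Lambda>"
begin

abbreviation \<phi> :: "('n \<Rightarrow> nat) \<Rightarrow> (real, 'n) vec \<Rightarrow> (real, 'n) vec" where
  "\<phi> \<equiv> diag_map r t"

lemma \<phi>_nth: "\<phi> a x $ k = r k (a k) * x $ k + t k (a k)"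
  by (simp add: diag_map_def coord_map_def)

lemma compact_sponge: "compact \<Lambda>" and sponge_nonempty: "\<Lambda> \<noteq> {}"
  and sponge_eq: "\<Lambda> = (\<Union>a\<in>D. \<phi> a ` \<Lambda>)"
  using lg by (auto simp: lalley_gatzouras_sponge_def attractor_def)

lemma digits_nonempty: "D \<noteq> {}"
  using lg by (auto simp: lalley_gatzouras_sponge_def diagonal_ifs_def)

lemma \<phi>_in_sponge: "a \<in> D \<Longrightarrow> x \<in> \<Lambda> \<Longrightarrow> \<phi> a x \<in> \<Lambda>"
  using sponge_eq by blast

lemma sponge_decompose:
  assumes "x \<in> \<Lambda>" obtains a y where "a \<in> D" "y \<in> \<Lambda>" "x = \<phi> a y"
  using assms sponge_eq by blast

lemma digit_less: "a \<in> D \<Longrightarrow> a k < n k"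
  using lg by (auto simp: lalley_gatzouras_sponge_def diagonal_ifs_def digits_def)

lemma finite_digits: "finite D"
proof -
  have "digits n = PiE UNIV (\<lambda>i. {..<n i})"
    by (auto simp: digits_def PiE_UNIV_domain)
  then have "finite (digits n)"
    by (simp add: finite_PiE)
  moreover have "D \<subseteq> digits n"
    using lg by (auto simp: lalley_gatzouras_sponge_def diagonal_ifs_def)
  ultimately show ?thesis by (rule rev_finite_subset)
qed

lemma
  assumes a: "a \<in> D"
  shows ratio_pos: "0 < r k (a k)" and ratio_less_1: "r k (a k) < 1"
    and shift_nonneg: "0 \<le> t k (a k)" and ratio_shift_le_1: "r k (a k) + t k (a k) \<le> 1"
proof -
  have *: "\<And>c. c < n k \<Longrightarrow> 0 < r k c \<and> r k c < 1 \<and> coord_map r t k c ` {0..1} \<subseteq> {0..1}"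
    using lg by (auto simp: lalley_gatzouras_sponge_def diagonal_ifs_def)
  note * = *[OF digit_less[OF a]]
  show "0 < r k (a k)" "r k (a k) < 1" using * by auto
  have "coord_map r t k (a k) 0 \<in> {0..1}" "coord_map r t k (a k) 1 \<in> {0..1}"
    using * by (auto simp: image_subset_iff)
  then show "0 \<le> t k (a k)" "r k (a k) + t k (a k) \<le> 1"
    by (auto simp: coord_map_def)
qed

lemma ratio_strict_antimono: "a \<in> D \<Longrightarrow> i < j \<Longrightarrow> r j (a j) < r i (a i)"
  using lg by (auto simp: lalley_gatzouras_sponge_def coordinate_ordering_def)

definition ratio_min :: real where
  "ratio_min = Min ((\<lambda>(a, k). r k (a k)) ` (D \<times> UNIV))"

definition ratio_max :: real where
  "ratio_max = Max ((\<lambda>(a, k). r k (a k)) ` (D \<times> UNIV))"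

lemma ratio_min_pos: "0 < ratio_min" and ratio_max_less_1: "ratio_max < 1"
  unfolding ratio_min_def ratio_max_def
  by (subst Min_gr_iff Max_less_iff; use finite_digits digits_nonempty ratio_pos ratio_less_1 in fastforce)+

lemma ratio_min_le: "a \<in> D \<Longrightarrow> ratio_min \<le> r k (a k)"
  unfolding ratio_min_def using finite_digits by (intro Min_le) (auto intro!: image_eqI[where x="(a, k)"])

lemma ratio_max_ge: "a \<in> D \<Longrightarrow> r k (a k) \<le> ratio_max"
  unfolding ratio_max_def using finite_digits by (intro Max_ge) (auto intro!: image_eqI[where x="(a, k)"])

lemma ratio_max_pos: "0 < ratio_max"
  using digits_nonempty ratio_pos ratio_max_ge by (metis all_not_in_conv less_le_trans)

text \<open>
  The largest value of a coordinate on the compact set is attained at an image point, and a contraction of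
  the unit interval into itself moves values above \<open>1\<close> strictly down; likewise for the smallest value.
\<close>
lemma sponge_coord_in_unit:
  assumes "x \<in> \<Lambda>" shows "0 \<le> x $ k" "x $ k \<le> 1"
proof -
  have cont: "continuous_on \<Lambda> (\<lambda>x. x $ k)"
    by (intro continuous_intros)
  obtain y where y: "y \<in> \<Lambda>" "\<And>z. z \<in> \<Lambda> \<Longrightarrow> z $ k \<le> y $ k"
    using continuous_attains_sup[OF compact_sponge sponge_nonempty cont] by blast
  obtain a z where a: "a \<in> D" "z \<in> \<Lambda>" "y = \<phi> a z" using sponge_decompose[OF y(1)] .
  have "r k (a k) * z $ k \<le> r k (a k) * y $ k"
    using ratio_pos[OF a(1), of k] y(2)[OF a(2)] by simp
  then have "y $ k \<le> r k (a k) * y $ k + (1 - r k (a k))"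
    using a ratio_shift_le_1[OF a(1), of k] by (simp add: \<phi>_nth)
  then have "(1 - r k (a k)) * (y $ k - 1) \<le> 0" by (simp add: algebra_simps)
  then have "y $ k \<le> 1"
    using ratio_less_1[OF a(1), of k] by (simp add: mult_le_0_iff)
  then show "x $ k \<le> 1" using y(2)[OF assms] by simp
next
  have cont: "continuous_on \<Lambda> (\<lambda>x. x $ k)"
    by (intro continuous_intros)
  obtain y where y: "y \<in> \<Lambda>" "\<And>z. z \<in> \<Lambda> \<Longrightarrow> y $ k \<le> z $ k"
    using continuous_attains_inf[OF compact_sponge sponge_nonempty cont] by blast
  obtain a z where a: "a \<in> D" "z \<in> \<Lambda>" "y = \<phi> a z" using sponge_decompose[OF y(1)] .
  have "r k (a k) * y $ k \<le> r k (a k) * z $ k"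
    using ratio_pos[OF a(1), of k] y(2)[OF a(2)] by simp
  then have "r k (a k) * y $ k \<le> y $ k"
    using a shift_nonneg[OF a(1), of k] by (simp add: \<phi>_nth)
  then have "(1 - r k (a k)) * y $ k \<ge> 0" by (simp add: algebra_simps)
  then have "0 \<le> y $ k"
    using ratio_less_1[OF a(1), of k] by (simp add: zero_le_mult_iff)
  then show "0 \<le> x $ k" using y(2)[OF assms] by simp
qed

lemma \<phi>_diff: "\<phi> a x $ k - \<phi> a y $ k = r k (a k) * (x $ k - y $ k)"
  by (simp add: \<phi>_nth algebra_simps)

lemma abs_\<phi>_diff: "a \<in> D \<Longrightarrow> \<bar>\<phi> a x $ k - \<phi> a y $ k\<bar> = r k (a k) * \<bar>x $ k - y $ k\<bar>"
  using ratio_pos[of a k] by (simp add: \<phi>_diff abs_mult)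

definition word_map :: "('n \<Rightarrow> nat) list \<Rightarrow> (real, 'n) vec \<Rightarrow> (real, 'n) vec" where
  "word_map w = foldr (\<lambda>a f. \<phi> a \<circ> f) w id"

lemma word_map_simps [simp]:
  "word_map [] x = x" "word_map (a # w) x = \<phi> a (word_map w x)"
  by (simp_all add: word_map_def)

definition word_ratio :: "('n \<Rightarrow> nat) list \<Rightarrow> 'n \<Rightarrow> real" where
  "word_ratio w k = (\<Prod>a\<leftarrow>w. r k (a k))"

lemma word_ratio_simps [simp]:
  "word_ratio [] k = 1" "word_ratio (a # w) k = r k (a k) * word_ratio w k"
  by (simp_all add: word_ratio_def)

lemma word_map_in_sponge: "set w \<subseteq> D \<Longrightarrow> x \<in> \<Lambda> \<Longrightarrow> word_map w x \<in> \<Lambda>"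
  by (induction w) (auto intro: \<phi>_in_sponge)

lemma word_ratio_pos: "set w \<subseteq> D \<Longrightarrow> 0 < word_ratio w k"
  by (induction w) (auto intro!: mult_pos_pos ratio_pos)

lemma word_ratio_le_power: "set w \<subseteq> D \<Longrightarrow> word_ratio w k \<le> ratio_max ^ length w"
proof (induction w)
  case (Cons a w)
  then show ?case
    using ratio_max_ge[of a k] ratio_pos[of a k] word_ratio_pos[of w k]
    by (auto intro!: mult_mono simp: ratio_max_pos less_imp_le)
qed simp

lemma word_map_diff: "word_map w x $ k - word_map w y $ k = word_ratio w k * (x $ k - y $ k)"
  by (induction w) (simp_all add: \<phi>_diff)

lemma sponge_point_in_cylinder:
  assumes "x \<in> \<Lambda>" shows "\<exists>w. set w \<subseteq> D \<and> length w = N \<and> x \<in> word_map w ` \<Lambda>"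
  using assms
proof (induction N arbitrary: x)
  case 0
  then show ?case by (intro exI[of _ "[]"]) auto
next
  case (Suc N)
  obtain a y where a: "a \<in> D" "y \<in> \<Lambda>" "x = \<phi> a y" using sponge_decompose[OF Suc.prems] .
  obtain w where w: "set w \<subseteq> D" "length w = N" "y \<in> word_map w ` \<Lambda>" using Suc.IH[OF a(2)] by blast
  then show ?case using a by (intro exI[of _ "a # w"]) auto
qed

text \<open>
  Long words have small images; one of them contains the given point.
\<close>
lemma small_cylinder_around_point:
  assumes "x \<in> \<Lambda>" "0 < c"
  obtains w where "set w \<subseteq> D" "\<And>y k. y \<in> \<Lambda> \<Longrightarrow> \<bar>word_map w y $ k - x $ k\<bar> < c"
proof -
  obtain N where N: "ratio_max ^ N < c"
    using real_arch_pow_inv[OF assms(2) ratio_max_less_1] by blast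
  obtain w z where w: "set w \<subseteq> D" "length w = N" "z \<in> \<Lambda>" "x = word_map w z"
    using sponge_point_in_cylinder[OF assms(1), of N] by blast
  have "\<bar>word_map w y $ k - x $ k\<bar> < c" if "y \<in> \<Lambda>" for y k
  proof -
    have "\<bar>word_map w y $ k - x $ k\<bar> = word_ratio w k * \<bar>y $ k - z $ k\<bar>"
      using word_ratio_pos[OF w(1), of k] by (simp add: w(4) word_map_diff abs_mult)
    also have "\<dots> \<le> word_ratio w k * 1"
      using word_ratio_pos[OF w(1), of k] sponge_coord_in_unit[OF that, of k]
        sponge_coord_in_unit[OF w(3), of k] by (intro mult_left_mono) auto
    also have "\<dots> < c" using word_ratio_le_power[OF w(1), of k] N w(2) by simp
    finally show ?thesis .
  qed
  then show ?thesis using that w(1) by blast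
qed

lemma cylindersE:
  assumes "R \<in> cylinders r t D \<Lambda>"
  obtains w where "set w \<subseteq> D" "R = word_map w ` \<Lambda>"
  using assms unfolding cylinders_def word_map_def by blast

section \<open>Scaled side lengths and their weights\<close>

text \<open>
  A state records the side lengths of a cylinder divided by the target scale $\delta$. By the coordinate
  ordering the sides of a cylinder decrease with the coordinate, so the last coordinate is the first whose scaled
  side drops below \<open>1\<close>.
\<close>
definition state :: "('n \<Rightarrow> real) \<Rightarrow> bool" where
  "state \<sigma> \<longleftrightarrow> antimono \<sigma> \<and> (\<forall>k. 0 < \<sigma> k)"

definition step :: "('n \<Rightarrow> real) \<Rightarrow> ('n \<Rightarrow> nat) \<Rightarrow> 'n \<Rightarrow> real" where
  "step \<sigma> a = (\<lambda>k. \<sigma> k * r k (a k))"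

text \<open>
  With $\gamma = \beta$ this is, up to constants, the number of approximate cubes into which a cylinder with
  scaled sides \<open>\<sigma>\<close> has to be cut when only the coordinates in \<open>A\<close> matter.
\<close>
definition pot :: "('n \<Rightarrow> real) \<Rightarrow> 'n set \<Rightarrow> ('n \<Rightarrow> real) \<Rightarrow> real" where
  "pot \<gamma> A \<sigma> = (\<Prod>k\<in>A. \<sigma> k powr \<gamma> k)"

lemma state_pos: "state \<sigma> \<Longrightarrow> 0 < \<sigma> k" and state_antimono: "state \<sigma> \<Longrightarrow> i \<le> j \<Longrightarrow> \<sigma> j \<le> \<sigma> i"
  by (auto simp: state_def antimono_def)

lemma state_step: assumes "state \<sigma>" "a \<in> D" shows "state (step \<sigma> a)"
  unfolding state_def
proof (intro conjI allI monotoneI)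
  fix i j :: 'n assume "i \<le> j"
  have "r j (a j) \<le> r i (a i)"
    using ratio_strict_antimono[OF assms(2), of i j] \<open>i \<le> j\<close> by (cases "i = j") (auto simp: less_le)
  then show "step \<sigma> a i \<ge> step \<sigma> a j"
    unfolding step_def using state_antimono[OF assms(1) \<open>i \<le> j\<close>] ratio_pos[OF assms(2), of j]
      state_pos[OF assms(1)] by (intro mult_mono) (auto simp: less_imp_le)
qed (use assms ratio_pos state_pos in \<open>auto simp: step_def\<close>)

lemma step_ge_ratio_min:
  assumes "state \<sigma>" "a \<in> D" "1 < \<sigma> i" "k \<le> i"
  shows "ratio_min \<le> step \<sigma> a k"
proof -
  have "1 \<le> \<sigma> k" using state_antimono[OF assms(1,4)] assms(3) by simp
  then have "1 * r k (a k) \<le> \<sigma> k * r k (a k)"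
    using ratio_pos[OF assms(2), of k] by (intro mult_right_mono) (simp_all add: less_imp_le)
  then show ?thesis using ratio_min_le[OF assms(2), of k] by (simp add: step_def)
qed

lemma step_le_power:
  assumes "state \<sigma>" "a \<in> D" "\<sigma> i \<le> (1 / ratio_max) ^ Suc N"
  shows "step \<sigma> a i \<le> (1 / ratio_max) ^ N"
proof -
  have "step \<sigma> a i \<le> (1 / ratio_max) ^ Suc N * ratio_max"
    unfolding step_def using assms(3) ratio_max_ge[OF assms(2)] ratio_pos[OF assms(2), of i] ratio_max_pos
    by (intro mult_mono) (auto simp: less_imp_le)
  then show ?thesis using ratio_max_pos by simp
qed

lemma pot_pos: "state \<sigma> \<Longrightarrow> 0 < pot \<gamma> A \<sigma>"
  unfolding pot_def using state_pos by (intro prod_pos) (auto simp: less_imp_neq[THEN not_sym])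

lemma pot_empty [simp]: "pot \<gamma> {} \<sigma> = 1"
  by (simp add: pot_def)

lemma pot_mult:
  assumes "\<And>k. 0 \<le> \<sigma> k" "\<And>k. 0 \<le> \<tau> k"
  shows "pot \<gamma> A (\<lambda>k. \<sigma> k * \<tau> k) = pot \<gamma> A \<sigma> * pot \<gamma> A \<tau>"
  unfolding pot_def using assms by (simp add: powr_mult prod.distrib)

definition digit_weight :: "('n \<Rightarrow> real) \<Rightarrow> 'n set \<Rightarrow> ('n \<Rightarrow> nat) \<Rightarrow> real" where
  "digit_weight \<gamma> A a = (\<Prod>k\<in>A. r k (a k) powr \<gamma> k)"

lemma digit_weight_pos: "a \<in> D \<Longrightarrow> 0 < digit_weight \<gamma> A a"
  unfolding digit_weight_def using ratio_pos by (intro prod_pos) (auto simp: less_imp_neq[THEN not_sym])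

lemma pot_step:
  "state \<sigma> \<Longrightarrow> a \<in> D \<Longrightarrow> pot \<gamma> A (step \<sigma> a) = pot \<gamma> A \<sigma> * digit_weight \<gamma> A a"
  using pot_mult[of \<sigma> "\<lambda>k. r k (a k)" \<gamma> A]
  by (simp add: step_def state_def less_imp_le ratio_pos digit_weight_def pot_def powr_mult prod.distrib)

lemma digit_weight_proj: "digit_weight \<gamma> {..i} (proj_coords i a) = digit_weight \<gamma> {..i} a"
  unfolding digit_weight_def by (intro prod.cong) (auto simp: proj_coords_def)

lemma proj_coords_eq_iff: "proj_coords i a = proj_coords i b \<longleftrightarrow> (\<forall>k\<in>{..i}. a k = b k)"
  by (metis (no_types, lifting) proj_coords_def restrict_apply' restrict_ext)

lemma pot_atMost: "pot \<gamma> {..i} \<sigma> = \<sigma> i powr \<gamma> i * pot \<gamma> {..<i} \<sigma>"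
proof -
  have "{..i} = insert i {..<i}" by auto
  then show ?thesis by (simp add: pot_def)
qed

text \<open>
  For the full digit set and the canonical exponents this sum is \<open>1\<close>, so that \<open>pot\<close> is preserved when a
  cylinder is replaced by its children.
\<close>
definition weight_sum :: "('n \<Rightarrow> real) \<Rightarrow> ('n \<Rightarrow> nat) set \<Rightarrow> 'n \<Rightarrow> real" where
  "weight_sum \<gamma> D' i = (\<Sum>b\<in>proj_coords i ` D'. digit_weight \<gamma> {..i} b)"

text \<open>
  Only the first coordinates of a digit matter, but \<open>step\<close> and the maps need a full digit. Hence one digit is
  chosen from each class.
\<close>
lemma representatives:
  obtains B where "B \<subseteq> D'" "inj_on (proj_coords i) B" "proj_coords i ` B = proj_coords i ` D'"
    "\<And>\<gamma>. weight_sum \<gamma> D' i = (\<Sum>a\<in>B. digit_weight \<gamma> {..i} a)"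
proof -
  obtain B where B: "B \<subseteq> D'" "inj_on (proj_coords i) B" "proj_coords i ` D' = proj_coords i ` B"
    using subset_image_inj[of "proj_coords i ` D'" "proj_coords i" D'] by auto
  have "weight_sum \<gamma> D' i = (\<Sum>a\<in>B. digit_weight \<gamma> {..i} a)" for \<gamma>
    unfolding weight_sum_def B(3) by (simp add: sum.reindex[OF B(2)] digit_weight_proj)
  then show ?thesis using that B by metis
qed

definition initial :: "'n set \<Rightarrow> bool" where
  "initial A \<longleftrightarrow> (\<forall>i\<in>A. {..i} \<subseteq> A)"

text \<open>
  The induction that follows the construction of approximate cubes: the largest coordinate is the one that is
  abandoned first.
\<close>
lemma initial_induct [consumes 1, case_names empty atMost]:
  assumes "initial A" and "P {}" and "\<And>i. P {..<i} \<Longrightarrow> P {..i}"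
  shows "P A"
proof -
  have "finite A" by simp
  then have "initial A \<longrightarrow> P A"
  proof (induction A rule: finite_linorder_max_induct)
    case empty then show ?case using assms(2) by simp
  next
    case (insert b A)
    show ?case
    proof
      assume "initial (insert b A)"
      then have sub: "{..b} \<subseteq> insert b A" by (auto simp: initial_def)
      then have A: "A = {..<b}" using insert(2) by (auto simp: less_le)
      have "initial A" unfolding A initial_def by auto
      then have "P {..<b}" using insert(3) A by simp
      moreover have "insert b A = {..b}" using A by auto
      ultimately show "P (insert b A)" using assms(3)[of b] by simp
    qed
  qed
  then show ?thesis using assms(1) by blast
qed

lemma initial_eq_atMost: "initial A \<Longrightarrow> A \<noteq> {} \<Longrightarrow> \<exists>i. A = {..i}"
  by (induction rule: initial_induct) auto

section \<open>Upper bounds for the size of nets\<close>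

text \<open>
  The quantity \<open>cnt A \<sigma> m\<close> stands for ``a net of size \<open>m\<close> suffices at the state \<open>\<sigma>\<close> if only the coordinates
  in \<open>A\<close> are looked at''. The lower bound \<open>L\<close> for the sides keeps the factors of abandoned coordinates
  bounded, whatever the signs of the exponents are.
\<close>
definition growth :: "('n set \<Rightarrow> ('n \<Rightarrow> real) \<Rightarrow> real \<Rightarrow> bool) \<Rightarrow> ('n \<Rightarrow> real) \<Rightarrow> 'n set \<Rightarrow> bool" where
  "growth cnt \<gamma> A \<longleftrightarrow>
     (\<forall>L>0. \<exists>C>0. \<forall>\<sigma>. state \<sigma> \<and> (\<forall>k\<in>A. L \<le> \<sigma> k) \<longrightarrow> cnt A \<sigma> (C * pot \<gamma> A \<sigma>))"

lemma le_power_of_inverse_ratio_max: "\<exists>N. x \<le> (1 / ratio_max) ^ N"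
  using real_arch_pow[of "1 / ratio_max" x] ratio_max_pos ratio_max_less_1 by (auto intro: less_imp_le)

text \<open>
  The recursion behind all upper bounds. As long as side \<open>i\<close> exceeds \<open>1\<close>, the cylinder is replaced by its
  children, and the bound is preserved because the weights add up to at most \<open>1\<close>. Once side \<open>i\<close> is at
  most \<open>1\<close> it lies between \<open>L0\<close> and \<open>1\<close>, and dropping its factor costs a constant only.
\<close>
lemma growth_atMost:
  assumes D': "D' \<subseteq> D"
    and mono: "\<And>A \<sigma> m m'. cnt A \<sigma> m \<Longrightarrow> m \<le> m' \<Longrightarrow> cnt A \<sigma> m'"
    and drop: "\<And>\<sigma> m. state \<sigma> \<Longrightarrow> \<sigma> i \<le> 1 \<Longrightarrow> cnt {..<i} \<sigma> m \<Longrightarrow> cnt {..i} \<sigma> m"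
    and branch: "\<And>\<sigma> B m. state \<sigma> \<Longrightarrow> B \<subseteq> D' \<Longrightarrow> proj_coords i ` B = proj_coords i ` D' \<Longrightarrow>
        (\<And>a. a \<in> B \<Longrightarrow> cnt {..i} (step \<sigma> a) (m a)) \<Longrightarrow> cnt {..i} \<sigma> (\<Sum>a\<in>B. m a)"
    and weight: "weight_sum \<gamma> D' i \<le> 1"
    and IH: "growth cnt \<gamma> {..<i}"
  shows "growth cnt \<gamma> {..i}"
  unfolding growth_def
proof (intro allI impI)
  fix L :: real assume "0 < L"
  define L0 where "L0 = min L ratio_min"
  have L0: "0 < L0" "L0 \<le> L" "L0 \<le> ratio_min"
    using \<open>0 < L\<close> ratio_min_pos by (auto simp: L0_def)
  obtain C' where C': "0 < C'"
    "\<And>\<sigma>. state \<sigma> \<Longrightarrow> \<forall>k\<in>{..<i}. L0 \<le> \<sigma> k \<Longrightarrow> cnt {..<i} \<sigma> (C' * pot \<gamma> {..<i} \<sigma>)"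
    using IH L0(1) unfolding growth_def by blast
  define z where "z = min 1 (L0 powr \<gamma> i)"
  have z: "0 < z" using L0 by (auto simp: z_def)
  define C where "C = C' / z"
  have C: "0 < C" using C' z by (simp add: C_def)
  obtain B where B: "B \<subseteq> D'" "proj_coords i ` B = proj_coords i ` D'"
    "weight_sum \<gamma> D' i = (\<Sum>a\<in>B. digit_weight \<gamma> {..i} a)"
    using representatives[of D' i] by metis
  have claim: "cnt {..i} \<sigma> (C * pot \<gamma> {..i} \<sigma>)"
    if "state \<sigma>" "\<forall>k\<in>{..i}. L0 \<le> \<sigma> k" "\<sigma> i \<le> (1 / ratio_max) ^ N" for \<sigma> N
    using that
  proof (induction N arbitrary: \<sigma>)
    case (0 \<sigma>)
    have "C' * pot \<gamma> {..<i} \<sigma> \<le> C * pot \<gamma> {..i} \<sigma>" if "\<sigma> i \<le> 1"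
      using powr_unit_bounds(1)[OF L0(1), of "\<sigma> i" "\<gamma> i"] 0 that z C' pot_pos[OF 0(1), of \<gamma> "{..<i}"]
      by (simp add: C_def pot_atMost z_def[symmetric] field_simps)
    then show ?case
      using 0 by (intro mono[OF drop[OF 0(1) _ C'(2)[OF 0(1)]]]) auto
  next
    case (Suc N \<sigma>)
    show ?case
    proof (cases "\<sigma> i \<le> 1")
      case True
      have "C' * pot \<gamma> {..<i} \<sigma> \<le> C * pot \<gamma> {..i} \<sigma>"
        using powr_unit_bounds(1)[OF L0(1), of "\<sigma> i" "\<gamma> i"] Suc.prems True z C'
          pot_pos[OF Suc.prems(1), of \<gamma> "{..<i}"]
        by (simp add: C_def pot_atMost z_def[symmetric] field_simps)
      then show ?thesis
        using Suc.prems True by (intro mono[OF drop[OF Suc.prems(1) _ C'(2)[OF Suc.prems(1)]]]) auto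
    next
      case False
      have "cnt {..i} (step \<sigma> a) (C * pot \<gamma> {..i} (step \<sigma> a))" if "a \<in> B" for a
      proof (rule Suc.IH)
        have a: "a \<in> D" using that B D' by auto
        show "state (step \<sigma> a)" using Suc.prems a by (simp add: state_step)
        show "\<forall>k\<in>{..i}. L0 \<le> step \<sigma> a k"
          using step_ge_ratio_min[OF Suc.prems(1) a] False L0(3) by (meson atMost_iff not_le order_trans)
        show "step \<sigma> a i \<le> (1 / ratio_max) ^ N"
          by (rule step_le_power[OF Suc.prems(1) a Suc.prems(3)])
      qed
      from branch[OF Suc.prems(1) B(1,2) this]
      have "cnt {..i} \<sigma> (\<Sum>a\<in>B. C * pot \<gamma> {..i} (step \<sigma> a))" .
      moreover have "(\<Sum>a\<in>B. C * pot \<gamma> {..i} (step \<sigma> a)) = C * pot \<gamma> {..i} \<sigma> * weight_sum \<gamma> D' i"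
        unfolding B(3) sum_distrib_left
        using B(1) D' Suc.prems(1) by (intro sum.cong) (auto simp: pot_step)
      moreover have "\<dots> \<le> C * pot \<gamma> {..i} \<sigma> * 1"
        using C pot_pos[OF Suc.prems(1), of \<gamma> "{..i}"] weight by (intro mult_left_mono) auto
      ultimately show ?thesis using mono by (metis mult.right_neutral)
    qed
  qed
  have "cnt {..i} \<sigma> (C * pot \<gamma> {..i} \<sigma>)" if "state \<sigma>" "\<forall>k\<in>{..i}. L \<le> \<sigma> k" for \<sigma>
  proof -
    obtain N where "\<sigma> i \<le> (1 / ratio_max) ^ N" using le_power_of_inverse_ratio_max by blast
    moreover have "\<forall>k\<in>{..i}. L0 \<le> \<sigma> k" using that(2) L0(2) by (meson order_trans)
    ultimately show ?thesis using claim that(1) by blast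
  qed
  then show "\<exists>C>0. \<forall>\<sigma>. state \<sigma> \<and> (\<forall>k\<in>{..i}. L \<le> \<sigma> k) \<longrightarrow> cnt {..i} \<sigma> (C * pot \<gamma> {..i} \<sigma>)"
    using C by blast
qed

lemma growth_extend:
  assumes D': "D' \<subseteq> D"
    and mono: "\<And>A \<sigma> m m'. cnt A \<sigma> m \<Longrightarrow> m \<le> m' \<Longrightarrow> cnt A \<sigma> m'"
    and drop: "\<And>i \<sigma> m. state \<sigma> \<Longrightarrow> \<sigma> i \<le> 1 \<Longrightarrow> cnt {..<i} \<sigma> m \<Longrightarrow> cnt {..i} \<sigma> m"
    and branch: "\<And>i \<sigma> B m. state \<sigma> \<Longrightarrow> B \<subseteq> D' \<Longrightarrow> proj_coords i ` B = proj_coords i ` D' \<Longrightarrow>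
        (\<And>a. a \<in> B \<Longrightarrow> cnt {..i} (step \<sigma> a) (m a)) \<Longrightarrow> cnt {..i} \<sigma> (\<Sum>a\<in>B. m a)"
    and A0: "initial A\<^sub>0" "growth cnt \<gamma> A\<^sub>0"
    and A: "initial A" "A\<^sub>0 \<subseteq> A"
    and weight: "\<And>i. i \<in> A - A\<^sub>0 \<Longrightarrow> weight_sum \<gamma> D' i \<le> 1"
  shows "growth cnt \<gamma> A"
proof -
  have "A\<^sub>0 \<subseteq> A \<longrightarrow> (\<forall>i\<in>A - A\<^sub>0. weight_sum \<gamma> D' i \<le> 1) \<longrightarrow> growth cnt \<gamma> A"
    using A(1)
  proof (induction rule: initial_induct)
    case empty
    then show ?case using A0 by auto
  next
    case (atMost i)
    show ?case
    proof (intro impI)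
      assume sub: "A\<^sub>0 \<subseteq> {..i}" and w: "\<forall>k\<in>{..i} - A\<^sub>0. weight_sum \<gamma> D' k \<le> 1"
      show "growth cnt \<gamma> {..i}"
      proof (cases "i \<in> A\<^sub>0")
        case True
        then have "A\<^sub>0 = {..i}" using sub A0(1) by (auto simp: initial_def)
        then show ?thesis using A0(2) by simp
      next
        case False
        then have "A\<^sub>0 \<subseteq> {..<i}" using sub by (auto simp: less_le)
        then have g: "growth cnt \<gamma> {..<i}" using atMost w by auto
        have wi: "weight_sum \<gamma> D' i \<le> 1" using w False by auto
        show ?thesis
        proof (rule growth_atMost[OF D' _ _ _ wi g])
          fix A \<sigma> m m' assume "cnt A \<sigma> m" "m \<le> m'" then show "cnt A \<sigma> m'" by (rule mono)
        next
          fix \<sigma> m assume "state \<sigma>" "\<sigma> i \<le> 1" "cnt {..<i} \<sigma> m"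
          then show "cnt {..i} \<sigma> m" by (rule drop)
        next
          fix \<sigma> B m assume *: "state \<sigma>" "B \<subseteq> D'" "proj_coords i ` B = proj_coords i ` D'"
            "\<And>a. a \<in> B \<Longrightarrow> cnt {..i} (step \<sigma> a) (m a)"
          show "cnt {..i} \<sigma> (\<Sum>a\<in>B. m a)" by (rule branch[OF *])
        qed
      qed
    qed
  qed
  then show ?thesis using A weight by blast
qed

definition close :: "'n set \<Rightarrow> ('n \<Rightarrow> real) \<Rightarrow> (real, 'n) vec \<Rightarrow> (real, 'n) vec \<Rightarrow> bool" where
  "close A \<sigma> x y \<longleftrightarrow> (\<forall>k\<in>A. \<sigma> k * \<bar>x $ k - y $ k\<bar> \<le> 1)"

definition has_net :: "(real, 'n) vec set \<Rightarrow> 'n set \<Rightarrow> ('n \<Rightarrow> real) \<Rightarrow> real \<Rightarrow> bool" where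
  "has_net E A \<sigma> m \<longleftrightarrow>
     (\<exists>P. finite P \<and> real (card P) \<le> m \<and> P \<subseteq> \<Lambda> \<and> (\<forall>x\<in>E. \<exists>p\<in>P. close A \<sigma> x p))"

text \<open>
  Chains whose steps have scaled length at most \<open>1\<close> in the coordinates of \<open>A\<close>; for \<open>A\<close> equal to \<open>{..j}\<close> these
  are chains in the projection to the first \<open>j\<close> coordinates.
\<close>
definition link :: "'n set \<Rightarrow> ('n \<Rightarrow> real) \<Rightarrow> ((real, 'n) vec \<times> (real, 'n) vec) set" where
  "link A \<sigma> = {(x, y). x \<in> \<Lambda> \<and> y \<in> \<Lambda> \<and> close A \<sigma> x y}"

definition has_chain_net :: "'n set \<Rightarrow> ('n \<Rightarrow> real) \<Rightarrow> real \<Rightarrow> bool" where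
  "has_chain_net A \<sigma> m \<longleftrightarrow>
     (\<exists>P. finite P \<and> real (card P) \<le> m \<and> P \<subseteq> \<Lambda> \<and> (\<forall>x\<in>\<Lambda>. \<exists>p\<in>P. (x, p) \<in> (link A \<sigma>)\<^sup>*))"

text \<open>
  All of the sponge fits into a box of side at most \<open>1\<close> in an abandoned coordinate.
\<close>
lemma close_drop:
  assumes "state \<sigma>" "\<sigma> i \<le> 1" "x \<in> \<Lambda>" "y \<in> \<Lambda>" "close {..<i} \<sigma> x y"
  shows "close {..i} \<sigma> x y"
  unfolding close_def
proof
  fix k assume "k \<in> {..i}"
  have "\<sigma> i * \<bar>x $ i - y $ i\<bar> \<le> 1 * 1"
    using sponge_coord_in_unit[of x i] sponge_coord_in_unit[of y i] assms state_pos[of \<sigma> i]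
    by (intro mult_mono) auto
  then show "\<sigma> k * \<bar>x $ k - y $ k\<bar> \<le> 1"
    using assms(5) \<open>k \<in> {..i}\<close> by (cases "k = i") (auto simp: close_def less_le)
qed

lemma close_\<phi>:
  assumes "a \<in> D" "b \<in> D" "proj_coords i a = proj_coords i b" "close {..i} (step \<sigma> a) x y"
  shows "close {..i} \<sigma> (\<phi> b x) (\<phi> a y)"
  unfolding close_def
proof
  fix k assume k: "k \<in> {..i}"
  then have "a k = b k" using assms(3) by (simp add: proj_coords_eq_iff)
  then have "\<phi> b x $ k = \<phi> a x $ k" by (simp add: \<phi>_nth)
  then show "\<sigma> k * \<bar>\<phi> b x $ k - \<phi> a y $ k\<bar> \<le> 1"
    using assms(4) k by (simp add: close_def step_def abs_\<phi>_diff[OF assms(1)] mult.assoc)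
qed

text \<open>
  The set \<open>E\<close> is the whole sponge or one of its faces, which is generated by a subset \<open>D'\<close> of the digits.
\<close>
lemma net_growth:
  assumes D': "D' \<subseteq> D" and E: "E \<subseteq> \<Lambda>" "E \<subseteq> (\<Union>a\<in>D'. \<phi> a ` E)"
    and A: "initial A" and weight: "\<And>i. i \<in> A \<Longrightarrow> weight_sum \<gamma> D' i \<le> 1"
  shows "growth (has_net E) \<gamma> A"
proof (rule growth_extend[where D' = D' and A\<^sub>0 = "{}"])
  show "D' \<subseteq> D" by fact
  show "has_net E A \<sigma> m'" if "has_net E A \<sigma> m" "m \<le> m'" for A \<sigma> m m'
    using that unfolding has_net_def by force
  show "has_net E {..i} \<sigma> m" if h: "state \<sigma>" "\<sigma> i \<le> 1" "has_net E {..<i} \<sigma> m" for i \<sigma> m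
  proof -
    obtain P where P: "finite P" "real (card P) \<le> m" "P \<subseteq> \<Lambda>" "\<forall>x\<in>E. \<exists>p\<in>P. close {..<i} \<sigma> x p"
      using h(3) unfolding has_net_def by blast
    then have "\<forall>x\<in>E. \<exists>p\<in>P. close {..i} \<sigma> x p"
      using close_drop[OF h(1,2)] E(1) by (meson subsetD)
    then show ?thesis using P unfolding has_net_def by blast
  qed
  show "has_net E {..i} \<sigma> (\<Sum>a\<in>B. m a)"
    if \<sigma>: "state \<sigma>" and B: "B \<subseteq> D'" "proj_coords i ` B = proj_coords i ` D'"
      and m: "\<And>a. a \<in> B \<Longrightarrow> has_net E {..i} (step \<sigma> a) (m a)" for i \<sigma> B m
  proof -
    have "\<forall>a\<in>B. \<exists>P. finite P \<and> real (card P) \<le> m a \<and> P \<subseteq> \<Lambda> \<and> (\<forall>x\<in>E. \<exists>p\<in>P. close {..i} (step \<sigma> a) x p)"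
      using m unfolding has_net_def by blast
    then obtain P where P: "\<And>a. a \<in> B \<Longrightarrow> finite (P a) \<and> real (card (P a)) \<le> m a"
      "\<And>a. a \<in> B \<Longrightarrow> P a \<subseteq> \<Lambda>" "\<And>a x. a \<in> B \<Longrightarrow> x \<in> E \<Longrightarrow> \<exists>p\<in>P a. close {..i} (step \<sigma> a) x p"
      by metis
    have finB: "finite B" using B D' finite_digits by (meson finite_subset)
    let ?P = "\<Union>a\<in>B. \<phi> a ` P a"
    have "\<exists>p\<in>?P. close {..i} \<sigma> x p" if x: "x \<in> E" for x
    proof -
      obtain b x' where b: "b \<in> D'" "x' \<in> E" "x = \<phi> b x'" using x E(2) by blast
      obtain a where a: "a \<in> B" "proj_coords i a = proj_coords i b"
        using b(1) B(2) by (metis (no_types, lifting) image_iff)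
      obtain p where "p \<in> P a" "close {..i} (step \<sigma> a) x' p" using P(3)[OF a(1) b(2)] by blast
      then show ?thesis
        using close_\<phi>[of a b i \<sigma> x' p] a b B(1) D' by blast
    qed
    moreover have "?P \<subseteq> \<Lambda>" using P(2) B(1) D' \<phi>_in_sponge by blast
    ultimately show ?thesis
      unfolding has_net_def using card_Union_images_le[OF finB P(1), where f = \<phi>]
      by (intro exI[of _ ?P]) simp
  qed
  show "initial {}" by (simp add: initial_def)
  obtain x0 where "x0 \<in> \<Lambda>" using sponge_nonempty by blast
  then have "has_net E {} \<sigma> 1" for \<sigma>
    unfolding has_net_def by (intro exI[of _ "{x0}"]) (auto simp: close_def)
  then show "growth (has_net E) \<gamma> {}"
    unfolding growth_def by (auto intro!: exI[of _ 1])
qed (use A weight in auto)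

lemma link_\<phi>:
  assumes "a \<in> D" "(x, y) \<in> (link {..i} (step \<sigma> a))\<^sup>*"
  shows "(\<phi> a x, \<phi> a y) \<in> (link {..i} \<sigma>)\<^sup>*"
  using assms(2)
proof (induction rule: rtrancl_induct)
  case (step y z)
  then have "(\<phi> a y, \<phi> a z) \<in> link {..i} \<sigma>"
    using close_\<phi>[OF assms(1) assms(1) refl, of i \<sigma> y z] \<phi>_in_sponge[OF assms(1)]
    by (auto simp: link_def)
  then show ?case using step.IH by (rule rtrancl_into_rtrancl[rotated])
qed simp

text \<open>
  Since the contractions map chains to chains, nets up to chains obey the same recursion. It may start from any
  set \<open>A\<^sub>0\<close> of coordinates for which a bound is already known.
\<close>
lemma chain_net_growth:
  assumes A0: "initial A\<^sub>0" "growth has_chain_net \<gamma> A\<^sub>0"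
    and A: "initial A" "A\<^sub>0 \<subseteq> A" and weight: "\<And>i. i \<in> A - A\<^sub>0 \<Longrightarrow> weight_sum \<gamma> D i \<le> 1"
  shows "growth has_chain_net \<gamma> A"
proof (rule growth_extend[where D' = D and A\<^sub>0 = A\<^sub>0])
  show "has_chain_net A \<sigma> m'" if "has_chain_net A \<sigma> m" "m \<le> m'" for A \<sigma> m m'
    using that unfolding has_chain_net_def by force
  show "has_chain_net {..i} \<sigma> m" if "state \<sigma>" "\<sigma> i \<le> 1" "has_chain_net {..<i} \<sigma> m" for i \<sigma> m
  proof -
    have "link {..<i} \<sigma> \<subseteq> link {..i} \<sigma>"
      using close_drop[OF that(1,2)] by (auto simp: link_def)
    then have "(link {..<i} \<sigma>)\<^sup>* \<subseteq> (link {..i} \<sigma>)\<^sup>*" by (rule rtrancl_mono)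
    then show ?thesis
      using that(3) unfolding has_chain_net_def by (meson subsetD)
  qed
  show "has_chain_net {..i} \<sigma> (\<Sum>a\<in>B. m a)"
    if \<sigma>: "state \<sigma>" and B: "B \<subseteq> D" "proj_coords i ` B = proj_coords i ` D"
      and m: "\<And>a. a \<in> B \<Longrightarrow> has_chain_net {..i} (step \<sigma> a) (m a)" for i \<sigma> B m
  proof -
    have "\<forall>a\<in>B. \<exists>P. finite P \<and> real (card P) \<le> m a \<and> P \<subseteq> \<Lambda> \<and>
        (\<forall>x\<in>\<Lambda>. \<exists>p\<in>P. (x, p) \<in> (link {..i} (step \<sigma> a))\<^sup>*)"
      using m unfolding has_chain_net_def by blast
    then obtain P where P: "\<And>a. a \<in> B \<Longrightarrow> finite (P a) \<and> real (card (P a)) \<le> m a"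
      "\<And>a. a \<in> B \<Longrightarrow> P a \<subseteq> \<Lambda>"
      "\<And>a x. a \<in> B \<Longrightarrow> x \<in> \<Lambda> \<Longrightarrow> \<exists>p\<in>P a. (x, p) \<in> (link {..i} (step \<sigma> a))\<^sup>*"
      by metis
    have finB: "finite B" using B finite_digits by (meson finite_subset)
    let ?P = "\<Union>a\<in>B. \<phi> a ` P a"
    have "\<exists>p\<in>?P. (x, p) \<in> (link {..i} \<sigma>)\<^sup>*" if x: "x \<in> \<Lambda>" for x
    proof -
      obtain b x' where b: "b \<in> D" "x' \<in> \<Lambda>" "x = \<phi> b x'" using sponge_decompose[OF x] .
      obtain a where a: "a \<in> B" "proj_coords i a = proj_coords i b"
        using b(1) B(2) by (metis (no_types, lifting) image_iff)
      have aD: "a \<in> D" using a B by auto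
      obtain p where p: "p \<in> P a" "(x', p) \<in> (link {..i} (step \<sigma> a))\<^sup>*" using P(3)[OF a(1) b(2)] by blast
      have "close {..i} \<sigma> x (\<phi> a x')"
        using close_\<phi>[OF aD b(1) a(2), of \<sigma> x' x'] b(3) by (simp add: close_def)
      then have "(x, \<phi> a x') \<in> link {..i} \<sigma>"
        using x \<phi>_in_sponge[OF aD b(2)] by (simp add: link_def)
      then have "(x, \<phi> a p) \<in> (link {..i} \<sigma>)\<^sup>*"
        using link_\<phi>[OF aD p(2)] by (rule converse_rtrancl_into_rtrancl)
      then show ?thesis using p(1) a(1) by blast
    qed
    moreover have "?P \<subseteq> \<Lambda>" using P(2) B(1) \<phi>_in_sponge by blast
    ultimately show ?thesis
      unfolding has_chain_net_def using card_Union_images_le[OF finB P(1), where f = \<phi>]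
      by (intro exI[of _ ?P]) simp
  qed
qed (use assms in auto)

section \<open>Lower bounds from separated pieces\<close>

definition outside :: "'n set \<Rightarrow> (real, 'n) vec \<Rightarrow> bool" where
  "outside A y \<longleftrightarrow> (\<exists>k\<in>A. \<not> (0 < y $ k \<and> y $ k < 1))"

definition apart :: "'n set \<Rightarrow> ('n \<Rightarrow> real) \<Rightarrow> real \<Rightarrow> (real, 'n) vec \<Rightarrow> (real, 'n) vec \<Rightarrow> bool" where
  "apart A \<sigma> c x y \<longleftrightarrow> (\<exists>k\<in>A. c \<le> \<sigma> k * \<bar>x $ k - y $ k\<bar>)"

text \<open>
  If \<open>rigid\<close> holds, a piece has to stay away from the whole remaining sponge (this counts components);
  otherwise it has to stay away from the other pieces only (this counts points of a separated set).
\<close>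
definition rivals :: "bool \<Rightarrow> (real, 'n) vec set set \<Rightarrow> (real, 'n) vec set" where
  "rivals rigid \<V> = (if rigid then \<Lambda> else \<Union>\<V>)"

text \<open>
  Pieces also keep their distance from everything outside the open cube. This is what makes the property pass to
  images under the contractions, whose open image cubes are disjoint.
\<close>
definition separated :: "bool \<Rightarrow> 'n set \<Rightarrow> ('n \<Rightarrow> real) \<Rightarrow> real \<Rightarrow> (real, 'n) vec set set \<Rightarrow> bool" where
  "separated rigid A \<sigma> c \<V> \<longleftrightarrow> finite \<V> \<and> disjoint \<V> \<and>
     (\<forall>V\<in>\<V>. V \<noteq> {} \<and> V \<subseteq> \<Lambda> \<and>
        (\<forall>x\<in>V. \<forall>y. outside A y \<or> y \<in> rivals rigid \<V> - V \<longrightarrow> apart A \<sigma> c x y))"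

text \<open>
  Separation is measured in the coordinates of \<open>A\<close> only, where digits that agree on \<open>A\<close> act alike. Hence the
  images under all these digits must belong to the same piece.
\<close>
definition push :: "'n set \<Rightarrow> ('n \<Rightarrow> nat) \<Rightarrow> (real, 'n) vec set \<Rightarrow> (real, 'n) vec set" where
  "push A a V = {\<phi> b x | b x. b \<in> D \<and> x \<in> V \<and> (\<forall>k\<in>A. b k = a k)}"

definition pull :: "('n \<Rightarrow> nat) \<Rightarrow> (real, 'n) vec \<Rightarrow> (real, 'n) vec" where
  "pull a y = (\<chi> k. (y $ k - t k (a k)) / r k (a k))"

lemma \<phi>_pull: "a \<in> D \<Longrightarrow> \<phi> a (pull a y) = y"
  using ratio_pos[of a] by (simp add: vec_eq_iff \<phi>_nth pull_def less_imp_neq[THEN not_sym])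

lemma pull_\<phi>: "a \<in> D \<Longrightarrow> b k = a k \<Longrightarrow> pull a (\<phi> b x) $ k = x $ k"
  using ratio_pos[of a k] by (simp add: \<phi>_nth pull_def)

lemma outside_pull:
  assumes "a \<in> D" "outside A y" shows "outside A (pull a y)"
proof -
  obtain k where k: "k \<in> A" "\<not> (0 < y $ k \<and> y $ k < 1)" using assms by (auto simp: outside_def)
  have "0 < y $ k \<and> y $ k < 1" if z: "0 < pull a y $ k" "pull a y $ k < 1"
  proof -
    have y: "y $ k = r k (a k) * pull a y $ k + t k (a k)"
      using \<phi>_nth[of a "pull a y" k] \<phi>_pull[OF assms(1), of y] by simp
    have "0 < r k (a k) * pull a y $ k" "r k (a k) * pull a y $ k < r k (a k)"
      using ratio_pos[OF assms(1), of k] z by auto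
    then show ?thesis
      using y shift_nonneg[OF assms(1), of k] ratio_shift_le_1[OF assms(1), of k] by linarith
  qed
  then show ?thesis using k by (auto simp: outside_def)
qed

text \<open>
  The form in which the neat projection condition is used: seen from the cylinder of \<open>a\<close>, every point of another
  cylinder lies outside the open cube. An open interval that meets a closed one also meets its interior, so
  otherwise the two open image cubes would intersect.
\<close>
lemma outside_pull_other_digit:
  assumes a: "a \<in> D" and b: "b \<in> D" and A: "initial A" and neq: "\<exists>k\<in>A. b k \<noteq> a k" and x: "x \<in> \<Lambda>"
  shows "outside A (pull a (\<phi> b x))"
proof (rule ccontr)
  assume no: "\<not> ?thesis"
  obtain i where i: "A = {..i}" using A neq initial_eq_atMost by (metis empty_iff)
  let ?y = "\<phi> b x"
  have "\<exists>u v. 0 < u \<and> u < 1 \<and> 0 < v \<and> v < 1 \<and> coord_map r t k (a k) u = coord_map r t k (b k) v"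
    if k: "k \<in> A" for k
  proof -
    have ra: "0 < r k (a k)" and rb: "0 < r k (b k)" using ratio_pos a b by auto
    have z: "0 < pull a ?y $ k" "pull a ?y $ k < 1" using no k by (auto simp: outside_def)
    have y: "?y $ k = r k (a k) * pull a ?y $ k + t k (a k)"
      using \<phi>_nth[of a "pull a ?y" k] \<phi>_pull[OF a, of ?y] by simp
    have "0 < r k (a k) * pull a ?y $ k" "r k (a k) * pull a ?y $ k < r k (a k)"
      using ra z by auto
    then have 1: "t k (a k) < ?y $ k" "?y $ k < t k (a k) + r k (a k)" using y by auto
    have "0 \<le> r k (b k) * x $ k" "r k (b k) * x $ k \<le> r k (b k)"
      using rb sponge_coord_in_unit[OF x, of k] by (auto simp: mult_left_le)
    then have 2: "t k (b k) \<le> ?y $ k" "?y $ k \<le> t k (b k) + r k (b k)" by (auto simp: \<phi>_nth)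
    obtain z where z: "t k (a k) < z" "z < t k (a k) + r k (a k)" "t k (b k) < z" "z < t k (b k) + r k (b k)"
      using open_intervals_meet[OF 1 2 rb] by metis
    show ?thesis
      by (rule exI[of _ "(z - t k (a k)) / r k (a k)"], rule exI[of _ "(z - t k (b k)) / r k (b k)"])
        (use z ra rb in \<open>auto simp: coord_map_def field_simps\<close>)
  qed
  then obtain u v where uv: "\<And>k. k \<in> A \<Longrightarrow> 0 < u k \<and> u k < 1 \<and> 0 < v k \<and> v k < 1 \<and>
      coord_map r t k (a k) (u k) = coord_map r t k (b k) (v k)" by metis
  let ?P = "\<lambda>b. proj_map r t i b ` ({..i} \<rightarrow>\<^sub>E {0<..<1})"
  have proj: "proj_map r t i (proj_coords i c) (restrict w {..i}) = (\<lambda>k\<in>{..i}. coord_map r t k (c k) (w k))" for c w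
    by (auto simp: proj_map_def proj_coords_def)
  have "proj_map r t i (proj_coords i a) (restrict u {..i}) = proj_map r t i (proj_coords i b) (restrict v {..i})"
    unfolding proj using uv i by (intro restrict_ext) auto
  moreover have "restrict u {..i} \<in> {..i} \<rightarrow>\<^sub>E {0<..<1}" "restrict v {..i} \<in> {..i} \<rightarrow>\<^sub>E {0<..<1}"
    using uv i by (simp_all add: restrict_PiE_iff)
  ultimately have "proj_map r t i (proj_coords i a) (restrict u {..i}) \<in> ?P (proj_coords i a) \<inter> ?P (proj_coords i b)"
    by (intro IntI) (rule imageI, assumption, rule image_eqI[of _ _ "restrict v {..i}"], assumption, assumption)
  then have "?P (proj_coords i a) \<inter> ?P (proj_coords i b) \<noteq> {}" by blast
  moreover have "proj_coords i a \<noteq> proj_coords i b" using neq i by (metis proj_coords_eq_iff)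
  moreover have "disjoint_family_on ?P (proj_coords i ` D)"
    using lg by (auto simp: lalley_gatzouras_sponge_def neat_projection_def)
  ultimately show False using a b by (auto simp: disjoint_family_on_def)
qed

lemma apart_pull:
  assumes "a \<in> D" "\<forall>k\<in>A. b k = a k" "apart A (step \<sigma> a) c x (pull a y)"
  shows "apart A \<sigma> c (\<phi> b x) y"
proof -
  obtain k where k: "k \<in> A" "c \<le> \<sigma> k * r k (a k) * \<bar>x $ k - pull a y $ k\<bar>"
    using assms(3) by (auto simp: apart_def step_def)
  have "\<phi> b x $ k = \<phi> a x $ k" using assms(2) k(1) by (simp add: \<phi>_nth)
  moreover have "y $ k = \<phi> a (pull a y) $ k" using \<phi>_pull[OF assms(1)] by simp
  ultimately have "\<bar>\<phi> b x $ k - y $ k\<bar> = r k (a k) * \<bar>x $ k - pull a y $ k\<bar>"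
    using abs_\<phi>_diff[OF assms(1)] by metis
  then have "c \<le> \<sigma> k * \<bar>\<phi> b x $ k - y $ k\<bar>" using k by (simp add: mult.assoc)
  then show ?thesis using k(1) unfolding apart_def by blast
qed

lemma apart_cong: "(\<And>k. k \<in> A \<Longrightarrow> y $ k = z $ k) \<Longrightarrow> apart A \<sigma> c x y = apart A \<sigma> c x z"
  by (simp add: apart_def)

lemma not_apart_self: "0 < c \<Longrightarrow> (\<And>k. k \<in> A \<Longrightarrow> x $ k = y $ k) \<Longrightarrow> \<not> apart A \<sigma> c x y"
  by (auto simp: apart_def)

text \<open>
  Pieces in the same child are separated by assumption. Points of other children, and points outside the cube, lie
  outside the open cube of the child, from which the pieces of this child keep their distance.
\<close>
lemma separated_push:
  assumes A: "initial A" and B: "B \<subseteq> D" "\<And>a b. a \<in> B \<Longrightarrow> b \<in> B \<Longrightarrow> a \<noteq> b \<Longrightarrow> \<exists>k\<in>A. a k \<noteq> b k"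
    and c: "0 < c" and F: "\<And>a. a \<in> B \<Longrightarrow> separated rigid A (step \<sigma> a) c (F a)"
  defines "G \<equiv> \<lambda>(a, V). push A a V"
  shows "separated rigid A \<sigma> c (G ` Sigma B F)" "inj_on G (Sigma B F)"
proof -
  have finB: "finite B" using B finite_digits by (meson finite_subset)
  have FD: "finite (F a)" "disjoint (F a)" if "a \<in> B" for a
    using F[OF that] by (auto simp: separated_def)
  have FV: "V \<noteq> {}" "V \<subseteq> \<Lambda>" if "a \<in> B" "V \<in> F a" for a V
    using F[OF that(1)] that(2) by (auto simp: separated_def)
  have FA: "apart A (step \<sigma> a) c x y"
    if "a \<in> B" "V \<in> F a" "x \<in> V" "outside A y \<or> y \<in> rivals rigid (F a) - V" for a V x y
    using F[OF that(1)] that(2-) by (auto simp: separated_def)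
  have sub: "push A a V \<subseteq> \<Lambda>" if "a \<in> B" "V \<in> F a" for a V
    using FV[OF that] \<phi>_in_sponge by (auto simp: push_def)
  have disj: "push A a V \<inter> push A b W = {}" if aV: "a \<in> B" "V \<in> F a" and bW: "b \<in> B" "W \<in> F b" and ne: "(a, V) \<noteq> (b, W)"
    for a b V W
  proof (rule ccontr)
    assume "push A a V \<inter> push A b W \<noteq> {}"
    then obtain a' b' x y where x: "a' \<in> D" "x \<in> V" "\<forall>k\<in>A. a' k = a k" and y: "b' \<in> D" "y \<in> W" "\<forall>k\<in>A. b' k = b k"
      and eq: "\<phi> a' x = \<phi> b' y" by (fastforce simp: push_def)
    have aD: "a \<in> D" using aV B by auto
    have yL: "y \<in> \<Lambda>" using FV[OF bW] y by auto
    have xk: "x $ k = pull a (\<phi> b' y) $ k" if "k \<in> A" for k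
      using pull_\<phi>[OF aD, of a' k x] x(3) that eq by simp
    show False
    proof (cases "a = b")
      case False
      then have "\<exists>k\<in>A. b' k \<noteq> a k" using B(2)[OF aV(1) bW(1)] y(3) by metis
      then have "outside A (pull a (\<phi> b' y))" using outside_pull_other_digit[OF aD y(1) A _ yL] by blast
      then have "apart A (step \<sigma> a) c x (pull a (\<phi> b' y))" using FA[OF aV x(2)] by blast
      then show False using not_apart_self[OF c] xk by blast
    next
      case True
      then have "V \<noteq> W" "W \<in> F a" using ne bW by auto
      then have "y \<notin> V" using FD(2)[OF aV(1)] aV(2) y(2) by (meson disjnt_iff pairwiseD)
      moreover have "y \<in> rivals rigid (F a)" using yL y(2) \<open>W \<in> F a\<close> by (auto simp: rivals_def)
      ultimately have "apart A (step \<sigma> a) c x y" using FA[OF aV x(2)] by blast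
      moreover have "x $ k = y $ k" if "k \<in> A" for k
        using xk[OF that] pull_\<phi>[OF aD, of b' k y] y(3) that True by simp
      ultimately show False using not_apart_self[OF c] by blast
    qed
  qed
  have ne: "push A a V \<noteq> {}" if "a \<in> B" "V \<in> F a" for a V
    using FV[OF that] B that(1) by (auto simp: push_def)
  show inj: "inj_on G (Sigma B F)"
  proof (rule inj_onI, rule ccontr)
    fix p q assume pq: "p \<in> Sigma B F" "q \<in> Sigma B F" "G p = G q" "p \<noteq> q"
    obtain a V b W where "p = (a, V)" "q = (b, W)" by (metis surj_pair)
    then show False using disj[of a V b W] ne[of a V] pq by (auto simp: G_def)
  qed
  have "apart A \<sigma> c x y"
    if a: "a \<in> B" and V: "V \<in> F a" and x: "x \<in> push A a V"
      and y: "outside A y \<or> y \<in> rivals rigid (G ` Sigma B F) - push A a V" for a V x y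
  proof -
    have aD: "a \<in> D" using a B by auto
    obtain a' x' where x': "a' \<in> D" "x' \<in> V" "\<forall>k\<in>A. a' k = a k" "x = \<phi> a' x'"
      using x by (auto simp: push_def)
    have "apart A (step \<sigma> a) c x' (pull a y)"
    proof (cases "outside A y")
      case True
      then show ?thesis using outside_pull[OF aD] FA[OF a V x'(2)] by blast
    next
      case False
      then have y: "y \<in> rivals rigid (G ` Sigma B F)" "y \<notin> push A a V" using y by auto
      have "\<exists>b y'. b \<in> D \<and> y' \<in> \<Lambda> \<and> y = \<phi> b y' \<and> ((\<forall>k\<in>A. b k = a k) \<longrightarrow> y' \<in> rivals rigid (F a))"
      proof (cases rigid)
        case True
        then have "y \<in> \<Lambda>" using y by (simp add: rivals_def)
        then show ?thesis using True sponge_decompose[of y] by (metis rivals_def)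
      next
        case False
        then obtain b0 W where W: "b0 \<in> B" "W \<in> F b0" "y \<in> push A b0 W"
          using y by (auto simp: rivals_def G_def)
        then obtain b y' where b: "b \<in> D" "y' \<in> W" "\<forall>k\<in>A. b k = b0 k" "y = \<phi> b y'"
          by (auto simp: push_def)
        have "y' \<in> rivals rigid (F a)" if "\<forall>k\<in>A. b k = a k"
        proof -
          have "a = b0" using that b(3) B(2)[OF a W(1)] by metis
          then show ?thesis using False W b by (auto simp: rivals_def)
        qed
        then show ?thesis using b FV[OF W(1,2)] by blast
      qed
      then obtain b y' where b: "b \<in> D" "y' \<in> \<Lambda>" "y = \<phi> b y'"
        "(\<forall>k\<in>A. b k = a k) \<Longrightarrow> y' \<in> rivals rigid (F a)" by blast
      show ?thesis
      proof (cases "\<forall>k\<in>A. b k = a k")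
        case False
        then have "outside A (pull a y)"
          using outside_pull_other_digit[OF aD b(1) A _ b(2)] b(3) by blast
        then show ?thesis using FA[OF a V x'(2)] by blast
      next
        case True
        have "y' \<notin> V" using y(2) b True by (auto simp: push_def)
        then have "apart A (step \<sigma> a) c x' y'" using FA[OF a V x'(2)] b(4)[OF True] by blast
        moreover have "pull a y $ k = y' $ k" if "k \<in> A" for k
          using pull_\<phi>[OF aD, of b k y'] True that b(3) by simp
        ultimately show ?thesis using apart_cong[of A "pull a y" y'] by blast
      qed
    qed
    then show ?thesis using apart_pull[OF aD x'(3)] x'(4) by simp
  qed
  moreover have "finite (G ` Sigma B F)" using finB FD by (intro finite_imageI finite_SigmaI) auto
  moreover have "disjoint (G ` Sigma B F)"
    using disj unfolding pairwise_def disjnt_def G_def by force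
  ultimately show "separated rigid A \<sigma> c (G ` Sigma B F)"
    unfolding separated_def using sub ne by (auto simp: G_def)
qed

definition steps :: "('n \<Rightarrow> real) \<Rightarrow> ('n \<Rightarrow> nat) list \<Rightarrow> 'n \<Rightarrow> real" where
  "steps \<sigma> w = (\<lambda>k. \<sigma> k * word_ratio w k)"

lemma steps_simps: "steps \<sigma> [] = \<sigma>" "steps \<sigma> (a # w) = steps (step \<sigma> a) w"
  by (auto simp: steps_def step_def)

lemma state_steps: "state \<sigma> \<Longrightarrow> set w \<subseteq> D \<Longrightarrow> state (steps \<sigma> w)"
  by (induction w arbitrary: \<sigma>) (auto simp: steps_simps state_step)

lemma separated_push_word:
  assumes "initial A" "set w \<subseteq> D" "0 < c" "separated rigid A (steps \<sigma> w) c \<V>"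
  shows "\<exists>g. separated rigid A \<sigma> c (g ` \<V>) \<and> inj_on g \<V> \<and> (\<forall>V\<in>\<V>. word_map w ` V \<subseteq> g V)"
  using assms(2,4)
proof (induction w arbitrary: \<sigma>)
  case Nil
  then show ?case by (intro exI[of _ id]) (simp add: steps_simps)
next
  case (Cons a w)
  have "set w \<subseteq> D" "separated rigid A (steps (step \<sigma> a) w) c \<V>"
    using Cons.prems by (auto simp: steps_simps)
  from Cons.IH[OF this]
  obtain g where g: "separated rigid A (step \<sigma> a) c (g ` \<V>)" "inj_on g \<V>" "\<forall>V\<in>\<V>. word_map w ` V \<subseteq> g V"
    by (elim exE conjE) (rule that)
  let ?G = "\<lambda>(a, V). push A a V"
  have P: "separated rigid A \<sigma> c (?G ` Sigma {a} (\<lambda>_. g ` \<V>))" "inj_on ?G (Sigma {a} (\<lambda>_. g ` \<V>))"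
    using separated_push[OF assms(1) _ _ assms(3), of "{a}" rigid \<sigma> "\<lambda>_. g ` \<V>"] Cons.prems(1) g(1) by auto
  have img: "?G ` Sigma {a} (\<lambda>_. g ` \<V>) = (push A a \<circ> g) ` \<V>" by force
  have inj: "inj_on (push A a \<circ> g) \<V>"
  proof (rule comp_inj_on[OF g(2)])
    show "inj_on (push A a) (g ` \<V>)"
      using P(2) by (force simp: inj_on_def)
  qed
  have "word_map (a # w) ` V \<subseteq> (push A a \<circ> g) V" if "V \<in> \<V>" for V
    using g(3) that Cons.prems(1) by (fastforce simp: push_def)
  then show ?case using P(1) inj unfolding img by blast
qed

text \<open>
  In the rigid case \<open>U\<close> is an island of the projection to the coordinates of \<open>A\<close>, otherwise merely a part that
  stays away from the boundary of the cube. In both cases a cylinder inside \<open>U\<close> is part of the data, since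
  smaller pieces will be placed into it.
\<close>
definition core :: "bool \<Rightarrow> 'n set \<Rightarrow> bool" where
  "core rigid A \<longleftrightarrow> (\<exists>w U c. set w \<subseteq> D \<and> 0 < c \<and> U \<subseteq> \<Lambda> \<and> word_map w ` \<Lambda> \<subseteq> U \<and>
     (\<forall>x\<in>U. \<forall>y. outside A y \<or> rigid \<and> y \<in> \<Lambda> - U \<longrightarrow> (\<exists>k\<in>A. c \<le> \<bar>x $ k - y $ k\<bar>)))"

definition separated_growth :: "bool \<Rightarrow> ('n \<Rightarrow> real) \<Rightarrow> 'n set \<Rightarrow> bool" where
  "separated_growth rigid \<gamma> A \<longleftrightarrow>
     (\<forall>L>0. \<exists>c>0. \<exists>\<kappa>>0. \<forall>\<sigma>. state \<sigma> \<and> (\<forall>k\<in>A. L \<le> \<sigma> k) \<longrightarrow>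
        (\<exists>\<V>. separated rigid A \<sigma> c \<V> \<and> \<kappa> * pot \<gamma> A \<sigma> \<le> real (card \<V>)))"

lemma separated_growth_empty: "separated_growth rigid \<gamma> {}"
proof -
  have "separated rigid {} \<sigma> 1 {\<Lambda>}" for \<sigma>
    using sponge_nonempty by (auto simp: separated_def outside_def rivals_def)
  then show ?thesis
    unfolding separated_growth_def by (intro allI impI exI[of _ 1] conjI exI[of _ "{\<Lambda>}"]) auto
qed

lemma separated_mono: "separated rigid A \<sigma> c \<V> \<Longrightarrow> c' \<le> c \<Longrightarrow> separated rigid A \<sigma> c' \<V>"
  unfolding separated_def apart_def by (meson order_trans)

text \<open>
  Abandoning coordinate \<open>i\<close>: the pieces for the remaining coordinates are transported into the cylinder of the
  core and intersected with \<open>U\<close>. Points outside \<open>U\<close>, or outside the cube in coordinate \<open>i\<close>, are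
  kept away by the core, all others by the pieces themselves. The word of the core is fixed, so its cost
  is a constant.
\<close>
lemma separated_growth_drop:
  assumes IH: "separated_growth rigid \<gamma> {..<i}" and core: "core rigid {..i}" and L: "0 < L"
  shows "\<exists>c>0. \<exists>\<kappa>>0. \<forall>\<sigma>. state \<sigma> \<and> (\<forall>k\<in>{..i}. L \<le> \<sigma> k) \<and> \<sigma> i \<le> 1 \<longrightarrow>
        (\<exists>\<V>. separated rigid {..i} \<sigma> c \<V> \<and> \<kappa> * pot \<gamma> {..i} \<sigma> \<le> real (card \<V>))"
proof -
  obtain w U c0 where w: "set w \<subseteq> D" and c0: "0 < c0" and U: "U \<subseteq> \<Lambda>" "word_map w ` \<Lambda> \<subseteq> U"
    and Usep: "\<forall>x\<in>U. \<forall>y. outside {..i} y \<or> rigid \<and> y \<in> \<Lambda> - U \<longrightarrow> (\<exists>k\<in>{..i}. c0 \<le> \<bar>x $ k - y $ k\<bar>)"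
    using core unfolding core_def by (elim exE conjE) (rule that)
  define m where "m = Min (range (word_ratio w))"
  have m: "0 < m" "\<And>k. m \<le> word_ratio w k"
    unfolding m_def using word_ratio_pos[OF w] by auto
  obtain c1 \<kappa>1 where c1: "0 < c1" "0 < \<kappa>1"
    "\<forall>\<sigma>. state \<sigma> \<and> (\<forall>k\<in>{..<i}. L * m \<le> \<sigma> k) \<longrightarrow>
      (\<exists>\<V>. separated rigid {..<i} \<sigma> c1 \<V> \<and> \<kappa>1 * pot \<gamma> {..<i} \<sigma> \<le> real (card \<V>))"
    using IH[unfolded separated_growth_def, rule_format, OF mult_pos_pos[OF L m(1)]]
    by (elim exE conjE) (rule that; simp)
  define c where "c = min c1 (L * c0)"
  have c: "0 < c" using c1 L c0 by (simp add: c_def)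
  define z where "z = max 1 (L powr \<gamma> i)"
  define \<kappa> where "\<kappa> = \<kappa>1 * pot \<gamma> {..<i} (word_ratio w) / z"
  have W: "0 < pot \<gamma> {..<i} (word_ratio w)"
    unfolding pot_def using word_ratio_pos[OF w] by (intro prod_pos) (auto simp: less_imp_neq[THEN not_sym])
  have z: "0 < z" by (simp add: z_def)
  have \<kappa>: "0 < \<kappa>" using c1 W z by (simp add: \<kappa>_def)
  have "\<exists>\<V>. separated rigid {..i} \<sigma> c \<V> \<and> \<kappa> * pot \<gamma> {..i} \<sigma> \<le> real (card \<V>)"
    if \<sigma>: "state \<sigma>" "\<forall>k\<in>{..i}. L \<le> \<sigma> k" "\<sigma> i \<le> 1" for \<sigma>
  proof -
    have "\<forall>k\<in>{..<i}. L * m \<le> steps \<sigma> w k"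
      unfolding steps_def using \<sigma>(2) L m by (auto intro!: mult_mono intro: less_imp_le order_trans)
    then obtain \<V> where \<V>: "separated rigid {..<i} (steps \<sigma> w) c1 \<V>"
      "\<kappa>1 * pot \<gamma> {..<i} (steps \<sigma> w) \<le> real (card \<V>)"
      using c1(3) state_steps[OF \<sigma>(1) w] by blast
    have init: "initial {..<i}" by (auto simp: initial_def)
    obtain g where g: "separated rigid {..<i} \<sigma> c (g ` \<V>)" "inj_on g \<V>" "\<forall>V\<in>\<V>. word_map w ` V \<subseteq> g V"
      using separated_push_word[OF init w c separated_mono[OF \<V>(1)]] by (auto simp: c_def)
    have \<V>': "V \<noteq> {}" "V \<subseteq> \<Lambda>" if "V \<in> \<V>" for V using \<V>(1) that by (auto simp: separated_def)
    have gV: "g V \<subseteq> \<Lambda>" if "V \<in> \<V>" for V using g(1) that by (auto simp: separated_def)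
    have gA: "apart {..<i} \<sigma> c x y" if "V \<in> \<V>" "x \<in> g V" "y \<in> rivals rigid (g ` \<V>) - g V" for V x y
      using g(1) that by (auto simp: separated_def)
    have gD: "g V \<inter> g W = {}" if "V \<in> \<V>" "W \<in> \<V>" "V \<noteq> W" for V W
    proof -
      have "g V \<noteq> g W" using g(2) that by (auto simp: inj_on_def)
      then show ?thesis using g(1) that by (auto simp: separated_def pairwise_def disjnt_def)
    qed
    let ?h = "\<lambda>V. U \<inter> g V"
    have ne: "?h V \<noteq> {}" if "V \<in> \<V>" for V using \<V>'[OF that] g(3) that U by blast
    have inj: "inj_on ?h \<V>" using ne gD by (intro inj_onI) blast
    have "apart {..i} \<sigma> c x y"
      if V: "V \<in> \<V>" "x \<in> ?h V" and y: "outside {..i} y \<or> y \<in> rivals rigid (?h ` \<V>) - ?h V" for V x y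
    proof (cases "outside {..i} y \<or> rigid \<and> y \<in> \<Lambda> - U")
      case True
      then obtain k where k: "k \<in> {..i}" "c0 \<le> \<bar>x $ k - y $ k\<bar>" using Usep V by blast
      then have "L * c0 \<le> \<sigma> k * \<bar>x $ k - y $ k\<bar>"
        using \<sigma>(2) L c0 by (intro mult_mono) (auto intro: order_trans less_imp_le)
      then have "c \<le> \<sigma> k * \<bar>x $ k - y $ k\<bar>" by (simp add: c_def)
      then show ?thesis using k(1) unfolding apart_def by blast
    next
      case False
      then have "y \<in> rivals rigid (g ` \<V>) - g V"
        using y V by (auto simp: rivals_def split: if_splits)
      then have "apart {..<i} \<sigma> c x y" using gA V by blast
      then show ?thesis by (auto simp: apart_def intro: less_imp_le)
    qed
    moreover have "finite (?h ` \<V>)" using \<V>(1) by (auto simp: separated_def)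
    moreover have "disjoint (?h ` \<V>)" using gD unfolding pairwise_def disjnt_def by fast
    ultimately have "separated rigid {..i} \<sigma> c (?h ` \<V>)"
      unfolding separated_def ball_simps using gV ne by (meson inf.coboundedI2)
    moreover have "\<kappa> * pot \<gamma> {..i} \<sigma> \<le> real (card (?h ` \<V>))"
    proof -
      have "\<sigma> i powr \<gamma> i \<le> z"
        unfolding z_def using powr_unit_bounds(2)[OF L] \<sigma> by auto
      then have "\<kappa> * pot \<gamma> {..i} \<sigma> \<le> \<kappa> * (z * pot \<gamma> {..<i} \<sigma>)"
        unfolding pot_atMost using \<kappa> pot_pos[OF \<sigma>(1), of \<gamma> "{..<i}"]
        by (intro mult_left_mono mult_right_mono) auto
      also have "\<dots> = \<kappa>1 * (pot \<gamma> {..<i} \<sigma> * pot \<gamma> {..<i} (word_ratio w))"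
        using z by (simp add: \<kappa>_def)
      also have "pot \<gamma> {..<i} \<sigma> * pot \<gamma> {..<i} (word_ratio w) = pot \<gamma> {..<i} (steps \<sigma> w)"
        unfolding steps_def using state_pos[OF \<sigma>(1)] word_ratio_pos[OF w]
        by (intro pot_mult[symmetric]) (auto intro: less_imp_le)
      also have "\<kappa>1 * \<dots> \<le> real (card \<V>)" by fact
      also have "card \<V> = card (?h ` \<V>)" using card_image[OF inj] by simp
      finally show ?thesis .
    qed
    ultimately show ?thesis by blast
  qed
  then show ?thesis using c \<kappa> by blast
qed

text \<open>
  The counterpart of the recursion for nets. Here equality of the weight sum with \<open>1\<close> prevents any loss when the
  pieces of all children are collected.
\<close>
lemma separated_growth_atMost:
  assumes IH: "separated_growth rigid \<gamma> {..<i}" and core: "core rigid {..i}"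
    and weight: "weight_sum \<gamma> D i = 1"
  shows "separated_growth rigid \<gamma> {..i}"
  unfolding separated_growth_def
proof (intro allI impI)
  fix L :: real assume "0 < L"
  define L0 where "L0 = min L ratio_min"
  have L0: "0 < L0" "L0 \<le> L" "L0 \<le> ratio_min"
    using \<open>0 < L\<close> ratio_min_pos by (auto simp: L0_def)
  obtain c \<kappa> where c: "0 < c" "0 < \<kappa>" and small:
    "\<forall>\<sigma>. state \<sigma> \<and> (\<forall>k\<in>{..i}. L0 \<le> \<sigma> k) \<and> \<sigma> i \<le> 1 \<longrightarrow>
      (\<exists>\<V>. separated rigid {..i} \<sigma> c \<V> \<and> \<kappa> * pot \<gamma> {..i} \<sigma> \<le> real (card \<V>))"
    using separated_growth_drop[OF IH core L0(1)] by (elim exE conjE) (rule that)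
  obtain B where B: "B \<subseteq> D" "inj_on (proj_coords i) B" "weight_sum \<gamma> D i = (\<Sum>a\<in>B. digit_weight \<gamma> {..i} a)"
    using representatives[of D i] by metis
  have finB: "finite B" using B finite_digits by (meson finite_subset)
  have init: "initial {..i}" by (auto simp: initial_def)
  have distinct: "\<exists>k\<in>{..i}. a k \<noteq> b k" if "a \<in> B" "b \<in> B" "a \<noteq> b" for a b
    using B(2) that by (metis inj_onD proj_coords_eq_iff)
  have claim: "\<exists>\<V>. separated rigid {..i} \<sigma> c \<V> \<and> \<kappa> * pot \<gamma> {..i} \<sigma> \<le> real (card \<V>)"
    if "state \<sigma>" "\<forall>k\<in>{..i}. L0 \<le> \<sigma> k" "\<sigma> i \<le> (1 / ratio_max) ^ N" for \<sigma> N
    using that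
  proof (induction N arbitrary: \<sigma>)
    case (0 \<sigma>)
    then show ?case using small by simp
  next
    case (Suc N \<sigma>)
    show ?case
    proof (cases "\<sigma> i \<le> 1")
      case True
      then show ?thesis using small Suc.prems by blast
    next
      case False
      have "\<exists>\<V>. separated rigid {..i} (step \<sigma> a) c \<V> \<and> \<kappa> * pot \<gamma> {..i} (step \<sigma> a) \<le> real (card \<V>)"
        if "a \<in> B" for a
      proof (rule Suc.IH)
        have a: "a \<in> D" using that B by auto
        show "state (step \<sigma> a)" using Suc.prems a by (simp add: state_step)
        show "\<forall>k\<in>{..i}. L0 \<le> step \<sigma> a k"
          using step_ge_ratio_min[OF Suc.prems(1) a] False L0(3) by (meson atMost_iff not_le order_trans)
        show "step \<sigma> a i \<le> (1 / ratio_max) ^ N"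
          by (rule step_le_power[OF Suc.prems(1) a Suc.prems(3)])
      qed
      then obtain F where F: "\<And>a. a \<in> B \<Longrightarrow> separated rigid {..i} (step \<sigma> a) c (F a)"
        "\<And>a. a \<in> B \<Longrightarrow> \<kappa> * pot \<gamma> {..i} (step \<sigma> a) \<le> real (card (F a))"
        by metis
      let ?G = "\<lambda>(a, V). push {..i} a V"
      have G: "separated rigid {..i} \<sigma> c (?G ` Sigma B F)" "inj_on ?G (Sigma B F)"
        by (rule separated_push[OF init B(1) _ c(1)]; fact distinct F(1))+
      have "\<kappa> * pot \<gamma> {..i} \<sigma> = \<kappa> * pot \<gamma> {..i} \<sigma> * weight_sum \<gamma> D i" by (simp add: weight)
      also have "\<dots> = (\<Sum>a\<in>B. \<kappa> * pot \<gamma> {..i} (step \<sigma> a))"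
        unfolding B(3) sum_distrib_left
        using B(1) Suc.prems(1) by (intro sum.cong) (auto simp: pot_step)
      also have "\<dots> \<le> (\<Sum>a\<in>B. real (card (F a)))" using F(2) by (intro sum_mono)
      also have "\<dots> = real (card (Sigma B F))"
        using finB F(1) by (simp add: separated_def)
      also have "\<dots> = real (card (?G ` Sigma B F))" using card_image[OF G(2)] by simp
      finally show ?thesis using G(1) by blast
    qed
  qed
  have "\<exists>\<V>. separated rigid {..i} \<sigma> c \<V> \<and> \<kappa> * pot \<gamma> {..i} \<sigma> \<le> real (card \<V>)"
    if "state \<sigma>" "\<forall>k\<in>{..i}. L \<le> \<sigma> k" for \<sigma>
  proof -
    obtain N where "\<sigma> i \<le> (1 / ratio_max) ^ N" using le_power_of_inverse_ratio_max by blast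
    moreover have "\<forall>k\<in>{..i}. L0 \<le> \<sigma> k" using that(2) L0(2) by (meson order_trans)
    ultimately show ?thesis using claim that(1) by blast
  qed
  then show "\<exists>c>0. \<exists>\<kappa>>0. \<forall>\<sigma>. state \<sigma> \<and> (\<forall>k\<in>{..i}. L \<le> \<sigma> k) \<longrightarrow>
      (\<exists>\<V>. separated rigid {..i} \<sigma> c \<V> \<and> \<kappa> * pot \<gamma> {..i} \<sigma> \<le> real (card \<V>))"
    using c by blast
qed

lemma separated_growth:
  assumes "initial A" "\<And>i. core rigid {..i}" "\<And>i. weight_sum \<gamma> D i = 1"
  shows "separated_growth rigid \<gamma> A"
  using assms(1)
  by (induction rule: initial_induct) (auto intro: separated_growth_empty separated_growth_atMost assms(2,3))

section \<open>Islands and the boundary of the cube\<close>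

text \<open>
  A contraction of the unit interval into itself attains an end point of the interval only at that same end point,
  which it then fixes.
\<close>
lemma face_decompose:
  assumes a: "a \<in> D" and x: "x \<in> \<Lambda>" and e: "e \<in> {0, 1}" and eq: "\<phi> a x $ k = e"
  shows "x $ k = e" "coord_map r t k (a k) e = e"
proof -
  have y: "r k (a k) * x $ k + t k (a k) = e" using eq by (simp add: \<phi>_nth)
  note facts = ratio_pos[OF a, of k] shift_nonneg[OF a, of k] ratio_shift_le_1[OF a, of k]
    sponge_coord_in_unit[OF x, of k]
  have 1: "0 \<le> r k (a k) * x $ k" "r k (a k) * x $ k \<le> r k (a k)"
    using facts by (auto simp: mult_left_le)
  have "x $ k = e"
  proof (cases "e = 0")
    case True
    then have "r k (a k) * x $ k = 0" using 1 y facts by linarith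
    then show ?thesis using facts True by simp
  next
    case False
    then have e1: "e = 1" using e by simp
    then have "r k (a k) * x $ k = r k (a k) * 1" using 1 y facts by linarith
    then show ?thesis using facts(1) e1 by (metis mult_left_cancel less_irrefl)
  qed
  then show "x $ k = e" "coord_map r t k (a k) e = e" using y by (auto simp: coord_map_def)
qed

text \<open>
  If all digits fixed \<open>e\<close> in coordinate \<open>k\<close>, contraction would force this coordinate to be constantly \<open>e\<close>, and
  the sponge would lie in a facet.
\<close>
lemma digit_leaving_face:
  assumes nd: "non_degenerated \<Lambda>" and e: "e \<in> {0, 1}"
  shows "\<exists>a\<in>D. coord_map r t k (a k) e \<noteq> e"
proof (rule ccontr)
  assume "\<not> ?thesis"
  then have fix_e: "r k (a k) * e + t k (a k) = e" if "a \<in> D" for a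
    using that by (auto simp: coord_map_def)
  have cont: "continuous_on \<Lambda> (\<lambda>x. \<bar>x $ k - e\<bar>)" by (intro continuous_intros)
  obtain x where x: "x \<in> \<Lambda>" "\<And>z. z \<in> \<Lambda> \<Longrightarrow> \<bar>z $ k - e\<bar> \<le> \<bar>x $ k - e\<bar>"
    using continuous_attains_sup[OF compact_sponge sponge_nonempty cont] by blast
  obtain a y where a: "a \<in> D" "y \<in> \<Lambda>" "x = \<phi> a y" using sponge_decompose[OF x(1)] .
  have "x $ k - e = r k (a k) * (y $ k - e)"
    using fix_e[OF a(1)] by (simp add: a(3) \<phi>_nth algebra_simps)
  then have "\<bar>x $ k - e\<bar> = r k (a k) * \<bar>y $ k - e\<bar>"
    using ratio_pos[OF a(1), of k] by (simp add: abs_mult)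
  also have "\<dots> \<le> r k (a k) * \<bar>x $ k - e\<bar>"
    using ratio_pos[OF a(1), of k] x(2)[OF a(2)] by (intro mult_left_mono) auto
  finally have "(1 - r k (a k)) * \<bar>x $ k - e\<bar> \<le> 0" by (simp add: algebra_simps)
  then have "\<bar>x $ k - e\<bar> \<le> 0" using ratio_less_1[OF a(1), of k] by (simp add: mult_le_0_iff)
  then have "z $ k = e" if "z \<in> \<Lambda>" for z using x(2)[OF that] by simp
  then have "\<Lambda> \<subseteq> {x \<in> cbox 0 One. x $ k = e}"
    using sponge_coord_in_unit by (auto simp: mem_unit_cube_iff)
  then show False using facet_of_unit_cube[OF e, of k] nd unfolding non_degenerated_def by blast
qed

text \<open>
  A digit that leaves a face moves every point off that face, and no digit moves a point onto a face on which it
  was not before. So the faces can be avoided one after the other.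
\<close>
lemma interior_sponge_point:
  assumes nd: "non_degenerated \<Lambda>"
  shows "\<exists>x\<in>\<Lambda>. \<forall>k. 0 < x $ k \<and> x $ k < 1"
proof -
  have avoid: "\<exists>x\<in>\<Lambda>. \<forall>(k, e)\<in>F. x $ k \<noteq> e" if "finite F" "F \<subseteq> UNIV \<times> {0, 1}" for F :: "('n \<times> real) set"
    using that
  proof (induction F rule: finite_induct)
    case empty
    then show ?case using sponge_nonempty by auto
  next
    case (insert f F)
    obtain k e where f: "f = (k, e)" "e \<in> {0, 1}" using insert.prems by auto
    obtain x where x: "x \<in> \<Lambda>" "\<forall>(k, e)\<in>F. x $ k \<noteq> e" using insert by auto
    obtain a where a: "a \<in> D" "coord_map r t k (a k) e \<noteq> e"
      using digit_leaving_face[OF nd f(2)] by blast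
    have "\<phi> a x $ k \<noteq> e" using face_decompose(2)[OF a(1) x(1) f(2)] a(2) by blast
    moreover have "\<phi> a x $ l \<noteq> e'" if "(l, e') \<in> F" for l e'
      using face_decompose(1)[OF a(1) x(1), of e' l] x(2) insert.prems that by blast
    ultimately show ?case using \<phi>_in_sponge[OF a(1) x(1)] f by blast
  qed
  obtain x where x: "x \<in> \<Lambda>" "\<forall>(k, e)\<in>UNIV \<times> {0, 1}. x $ k \<noteq> e"
    using avoid[of "UNIV \<times> {0, 1}"] by auto
  then have "0 < x $ k \<and> x $ k < 1" for k
    using sponge_coord_in_unit[OF x(1), of k] by (auto simp: less_le)
  then show ?thesis using x(1) by blast
qed

lemma core_of_non_degenerated:
  assumes nd: "non_degenerated \<Lambda>"
  shows "core False A"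
proof -
  obtain x where x: "x \<in> \<Lambda>" "\<And>k. 0 < x $ k \<and> x $ k < 1" using interior_sponge_point[OF nd] by blast
  define c where "c = Min (range (\<lambda>k. min (x $ k) (1 - x $ k))) / 2"
  have cpos: "0 < c" using x(2) by (simp add: c_def)
  have c: "2 * c \<le> x $ k" "2 * c \<le> 1 - x $ k" for k
  proof -
    have "Min (range (\<lambda>k. min (x $ k) (1 - x $ k))) \<le> min (x $ k) (1 - x $ k)" by (intro Min_le) auto
    then have "2 * c \<le> min (x $ k) (1 - x $ k)" by (simp add: c_def)
    then show "2 * c \<le> x $ k" "2 * c \<le> 1 - x $ k" by auto
  qed
  obtain w where w: "set w \<subseteq> D" "\<And>y k. y \<in> \<Lambda> \<Longrightarrow> \<bar>word_map w y $ k - x $ k\<bar> < c"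
    using small_cylinder_around_point[OF x(1) cpos] by blast
  have sep: "\<exists>k\<in>A. c \<le> \<bar>u $ k - y $ k\<bar>" if u: "u \<in> word_map w ` \<Lambda>" and y: "outside A y" for u y
  proof -
    obtain k where k: "k \<in> A" "\<not> (0 < y $ k \<and> y $ k < 1)" using y by (auto simp: outside_def)
    have "\<bar>u $ k - x $ k\<bar> < c" using u w(2) by auto
    then have "c \<le> \<bar>u $ k - y $ k\<bar>" using c[of k] k(2) by (auto simp: abs_if split: if_splits)
    then show ?thesis using k(1) by blast
  qed
  have "word_map w ` \<Lambda> \<subseteq> \<Lambda>" using word_map_in_sponge[OF w(1)] by auto
  then show ?thesis
    unfolding core_def using w(1) cpos sep
    by (intro exI[of _ w] exI[of _ "word_map w ` \<Lambda>"] exI[of _ c]) auto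
qed

lemma core_of_island:
  assumes U: "U \<subseteq> \<Lambda>" "U \<noteq> {}" and c: "0 < c"
    and sep: "\<forall>x\<in>U. \<forall>y. outside A y \<or> y \<in> \<Lambda> - U \<longrightarrow> (\<exists>k\<in>A. c \<le> \<bar>x $ k - y $ k\<bar>)"
  shows "core True A"
proof -
  obtain x where x: "x \<in> U" using U by blast
  then obtain w where w: "set w \<subseteq> D" "\<And>y k. y \<in> \<Lambda> \<Longrightarrow> \<bar>word_map w y $ k - x $ k\<bar> < c"
    using small_cylinder_around_point[of x c] U c by blast
  have "word_map w y \<in> U" if y: "y \<in> \<Lambda>" for y
  proof (rule ccontr)
    assume "word_map w y \<notin> U"
    then obtain k where "c \<le> \<bar>x $ k - word_map w y $ k\<bar>"
      using sep x word_map_in_sponge[OF w(1) y] by blast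
    then show False using w(2)[OF y, of k] by (simp add: abs_minus_commute)
  qed
  then show ?thesis
    unfolding core_def using w(1) c U(1) sep
    by (intro exI[of _ w] exI[of _ U] exI[of _ c]) auto
qed

text \<open>
  A chain class is at positive distance from the rest of the sponge. It is compact, so if it missed the boundary of
  the cube, it would stay away from it and form an island.
\<close>
lemma chain_to_boundary:
  assumes no: "\<not> core True A" and \<sigma>: "state \<sigma>" and x: "x \<in> \<Lambda>"
  shows "\<exists>y\<in>\<Lambda>. (x, y) \<in> (link A \<sigma>)\<^sup>* \<and> outside A y"
proof (rule ccontr)
  assume contra: "\<not> ?thesis"
  define C where "C = {y. (x, y) \<in> (link A \<sigma>)\<^sup>*}"
  have CL: "C \<subseteq> \<Lambda>"
  proof
    fix y assume "y \<in> C"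
    then have "(x, y) \<in> (link A \<sigma>)\<^sup>*" by (simp add: C_def)
    then show "y \<in> \<Lambda>" by (induction rule: rtrancl_induct) (auto simp: link_def x)
  qed
  have xC: "x \<in> C" by (simp add: C_def)
  define c1 where "c1 = Min (range (\<lambda>k. 1 / \<sigma> k))"
  have c1: "0 < c1" "\<And>k. c1 \<le> 1 / \<sigma> k"
    using state_pos[OF \<sigma>] by (auto simp: c1_def)
  have sep: "\<exists>k\<in>A. c1 \<le> \<bar>u $ k - y $ k\<bar>" if u: "u \<in> C" and y: "y \<in> \<Lambda> - C" for u y
  proof -
    have "(u, y) \<notin> link A \<sigma>" using u y by (auto simp: C_def intro: rtrancl_into_rtrancl)
    then obtain k where k: "k \<in> A" "1 < \<sigma> k * \<bar>u $ k - y $ k\<bar>"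
      using u y CL by (auto simp: link_def close_def not_le)
    then have "1 / \<sigma> k \<le> \<bar>u $ k - y $ k\<bar>"
      using state_pos[OF \<sigma>, of k] by (simp add: field_simps)
    then show ?thesis using k(1) c1(2)[of k] by (intro bexI[of _ k]) auto
  qed
  have "C = \<Lambda> - (\<Union>y\<in>\<Lambda> - C. ball y c1)"
  proof -
    have "u \<notin> ball y c1" if uy: "u \<in> C" "y \<in> \<Lambda> - C" for u y
    proof
      assume "u \<in> ball y c1"
      obtain k where "c1 \<le> \<bar>u $ k - y $ k\<bar>" using sep[OF uy] by blast
      also have "\<dots> \<le> dist u y" using component_le_norm_cart[of "u - y" k] by (simp add: dist_norm)
      finally show False using \<open>u \<in> ball y c1\<close> by (simp add: dist_commute)
    qed
    then show ?thesis using CL c1(1) by auto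
  qed
  then have "compact C" using compact_diff[OF compact_sponge] by (metis open_UN open_ball)
  have "\<exists>m>0. \<forall>u\<in>C. m \<le> u $ k \<and> m \<le> 1 - u $ k" if k: "k \<in> A" for k
  proof -
    have "continuous_on C (\<lambda>u. min (u $ k) (1 - u $ k))" by (intro continuous_intros)
    then obtain v where v: "v \<in> C" "\<And>u. u \<in> C \<Longrightarrow> min (v $ k) (1 - v $ k) \<le> min (u $ k) (1 - u $ k)"
      using continuous_attains_inf[OF \<open>compact C\<close>] xC by blast
    have "\<not> outside A v" using contra v(1) CL by (auto simp: C_def)
    then have "0 < min (v $ k) (1 - v $ k)" using k by (auto simp: outside_def)
    then show ?thesis using v(2) by (intro exI[of _ "min (v $ k) (1 - v $ k)"]) auto
  qed
  then obtain m where m: "\<And>k. k \<in> A \<Longrightarrow> 0 < m k" "\<And>k u. k \<in> A \<Longrightarrow> u \<in> C \<Longrightarrow> m k \<le> u $ k \<and> m k \<le> 1 - u $ k"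
    by metis
  define c where "c = Min (insert c1 (m ` A))"
  have c: "0 < c" "c \<le> c1" "\<And>k. k \<in> A \<Longrightarrow> c \<le> m k"
    using c1 m(1) by (auto simp: c_def)
  have "\<exists>k\<in>A. c \<le> \<bar>u $ k - y $ k\<bar>" if u: "u \<in> C" and y: "outside A y \<or> y \<in> \<Lambda> - C" for u y
    using y
  proof
    assume "outside A y"
    then obtain k where k: "k \<in> A" "\<not> (0 < y $ k \<and> y $ k < 1)" by (auto simp: outside_def)
    then have "c \<le> \<bar>u $ k - y $ k\<bar>" using c(3)[OF k(1)] m(2)[OF k(1) u] by auto
    then show ?thesis using k(1) by blast
  next
    assume "y \<in> \<Lambda> - C"
    then show ?thesis using sep[OF u, of y] c(2) by (meson order_trans)
  qed
  then have "core True A" using core_of_island[OF CL _ c(1)] xC by blast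
  then show False using no by blast
qed

section \<open>A smaller exponent in the absence of islands\<close>

lemma digit_weight_nonneg: "a \<in> D \<Longrightarrow> 0 \<le> digit_weight \<gamma> A a"
  using digit_weight_pos less_imp_le by blast

lemma digit_weight_update:
  assumes "a \<in> D"
  shows "digit_weight (\<gamma>(j := \<gamma> j + x)) {..i} a =
    digit_weight \<gamma> {..i} a * (if j \<le> i then r j (a j) powr x else 1)"
proof -
  have "digit_weight (\<gamma>(j := \<gamma> j + x)) {..i} a =
      (\<Prod>k\<in>{..i}. r k (a k) powr \<gamma> k * (if k = j then r j (a j) powr x else 1))"
    unfolding digit_weight_def by (intro prod.cong) (auto simp: powr_add)
  also have "\<dots> = digit_weight \<gamma> {..i} a * (\<Prod>k\<in>{..i}. if k = j then r j (a j) powr x else 1)"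
    by (simp add: prod.distrib digit_weight_def)
  also have "(\<Prod>k\<in>{..i}. if k = j then r j (a j) powr x else 1) = (if j \<le> i then r j (a j) powr x else 1)"
    by (simp add: prod.delta)
  finally show ?thesis .
qed

lemma weight_sum_mono:
  assumes "D' \<subseteq> D" "\<And>a. a \<in> D' \<Longrightarrow> digit_weight \<gamma> {..i} a \<le> digit_weight \<gamma>' {..i} a"
  shows "weight_sum \<gamma> D' i \<le> weight_sum \<gamma>' D' i"
  unfolding weight_sum_def
  by (intro sum_mono) (use assms in \<open>auto simp: digit_weight_proj\<close>)

lemma weight_sum_subset:
  assumes "D' \<subseteq> D"
  shows "weight_sum \<gamma> D' i \<le> weight_sum \<gamma> D i"
  unfolding weight_sum_def using assms finite_digits
  by (intro sum_mono2) (auto simp: digit_weight_proj digit_weight_nonneg)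

lemma weight_sum_psubset:
  assumes "D' \<subseteq> D" "a \<in> D" "proj_coords i a \<notin> proj_coords i ` D'"
  shows "weight_sum \<gamma> D' i < weight_sum \<gamma> D i"
  unfolding weight_sum_def
proof (rule sum_strict_mono2[of _ _ "proj_coords i a"])
  show "finite (proj_coords i ` D)" using finite_digits by simp
  show "0 < digit_weight \<gamma> {..i} (proj_coords i a)" using digit_weight_pos[OF assms(2)] by (simp add: digit_weight_proj)
qed (use assms in \<open>auto simp: digit_weight_proj digit_weight_nonneg\<close>)

lemma tendsto_weight_sum:
  assumes "D' \<subseteq> D"
  shows "((\<lambda>\<epsilon>. weight_sum (\<gamma>(j := \<gamma> j - \<epsilon>)) D' i) \<longlongrightarrow> weight_sum \<gamma> D' i) (at_right 0)"
proof -
  obtain B where B: "B \<subseteq> D'" "\<And>\<gamma>. weight_sum \<gamma> D' i = (\<Sum>a\<in>B. digit_weight \<gamma> {..i} a)"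
    using representatives[of D' i] by metis
  have lim: "((\<lambda>\<epsilon>. digit_weight (\<gamma>(j := \<gamma> j - \<epsilon>)) {..i} a) \<longlongrightarrow> digit_weight \<gamma> {..i} a) (at_right 0)"
    if a: "a \<in> B" for a
  proof -
    have aD: "a \<in> D" using a B assms by auto
    have "((\<lambda>\<epsilon>. r j (a j) powr (- \<epsilon>)) \<longlongrightarrow> r j (a j) powr (- 0)) (at_right 0)"
      by (intro tendsto_intros) (use ratio_pos[OF aD, of j] in auto)
    then have "((\<lambda>\<epsilon>. digit_weight \<gamma> {..i} a * (if j \<le> i then r j (a j) powr (- \<epsilon>) else 1)) \<longlongrightarrow>
        digit_weight \<gamma> {..i} a * 1) (at_right 0)"
      using ratio_pos[OF aD, of j] by (intro tendsto_mult tendsto_const) (cases "j \<le> i"; simp)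
    then show ?thesis using digit_weight_update[OF aD, of \<gamma> j "- _" i] by simp
  qed
  show ?thesis unfolding B(2) by (intro tendsto_sum lim)
qed

definition face :: "'n \<Rightarrow> real \<Rightarrow> (real, 'n) vec set" where
  "face k e = {x \<in> \<Lambda>. x $ k = e}"

definition face_digits :: "'n \<Rightarrow> real \<Rightarrow> ('n \<Rightarrow> nat) set" where
  "face_digits k e = {a \<in> D. coord_map r t k (a k) e = e}"

lemma face_subset: "e \<in> {0, 1} \<Longrightarrow> face k e \<subseteq> (\<Union>a\<in>face_digits k e. \<phi> a ` face k e)"
proof
  fix x assume e: "e \<in> {0, 1}" and x: "x \<in> face k e"
  then obtain a y where a: "a \<in> D" "y \<in> \<Lambda>" "x = \<phi> a y" using sponge_decompose[of x] by (auto simp: face_def)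
  then show "x \<in> (\<Union>a\<in>face_digits k e. \<phi> a ` face k e)"
    using face_decompose[OF a(1,2) e, of k] x by (auto simp: face_def face_digits_def)
qed

lemma weight_sum_face_less:
  assumes nd: "non_degenerated \<Lambda>" and e: "e \<in> {0, 1}" and k: "k \<le> i"
  shows "weight_sum \<gamma> (face_digits k e) i < weight_sum \<gamma> D i"
proof -
  obtain a where a: "a \<in> D" "coord_map r t k (a k) e \<noteq> e" using digit_leaving_face[OF nd e] by blast
  have "proj_coords i a \<noteq> proj_coords i b" if "b \<in> face_digits k e" for b
  proof -
    have "a k \<noteq> b k" using that a(2) by (auto simp: face_digits_def)
    then show ?thesis using k by (metis atMost_iff proj_coords_eq_iff)
  qed
  then show ?thesis using a(1) by (intro weight_sum_psubset[of _ a]) (auto simp: face_digits_def)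
qed

text \<open>
  Every point is chained to a face, so nets of the faces reach everything.
\<close>
lemma has_chain_net_of_faces:
  assumes no: "\<not> core True {..j}" and \<sigma>: "state \<sigma>"
    and m: "\<And>k e. k \<le> j \<Longrightarrow> e \<in> {0, 1} \<Longrightarrow> has_net (face k e) {..j} \<sigma> (m (k, e))"
  shows "has_chain_net {..j} \<sigma> (\<Sum>f\<in>{..j} \<times> {0, 1}. m f)"
proof -
  let ?F = "{..j} \<times> {0, 1 :: real}"
  have "\<forall>f\<in>?F. \<exists>P. finite P \<and> real (card P) \<le> m f \<and> P \<subseteq> \<Lambda> \<and>
      (\<forall>x\<in>face (fst f) (snd f). \<exists>p\<in>P. close {..j} \<sigma> x p)"
    using m unfolding has_net_def by auto
  then obtain P where P: "\<And>f. f \<in> ?F \<Longrightarrow> finite (P f) \<and> real (card (P f)) \<le> m f"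
    "\<And>f. f \<in> ?F \<Longrightarrow> P f \<subseteq> \<Lambda>"
    "\<And>f x. f \<in> ?F \<Longrightarrow> x \<in> face (fst f) (snd f) \<Longrightarrow> \<exists>p\<in>P f. close {..j} \<sigma> x p"
    by metis
  let ?P = "\<Union>f\<in>?F. P f"
  have "\<exists>p\<in>?P. (x, p) \<in> (link {..j} \<sigma>)\<^sup>*" if x: "x \<in> \<Lambda>" for x
  proof -
    obtain y where y: "y \<in> \<Lambda>" "(x, y) \<in> (link {..j} \<sigma>)\<^sup>*" "outside {..j} y"
      using chain_to_boundary[OF no \<sigma> x] by blast
    then obtain k where k: "k \<le> j" "y $ k \<le> 0 \<or> 1 \<le> y $ k" by (auto simp: outside_def not_less)
    then have "y $ k = 0 \<or> y $ k = 1" using sponge_coord_in_unit[OF y(1), of k] by auto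
    then have f: "(k, y $ k) \<in> ?F" "y \<in> face k (y $ k)" using k y by (auto simp: face_def)
    then obtain p where p: "p \<in> P (k, y $ k)" "close {..j} \<sigma> y p" using P(3)[OF f(1), of y] by auto
    have "(y, p) \<in> link {..j} \<sigma>" using p y(1) P(2)[OF f(1)] by (auto simp: link_def)
    then have "(x, p) \<in> (link {..j} \<sigma>)\<^sup>*" using y(2) by (rule rtrancl_into_rtrancl[rotated])
    then show ?thesis using p(1) f(1) by blast
  qed
  moreover have "?P \<subseteq> \<Lambda>" using P(2) by blast
  moreover have "finite ?P" "real (card ?P) \<le> (\<Sum>f\<in>?F. m f)"
    using card_Union_images_le[of ?F P m "\<lambda>_ x. x"] P(1) by auto
  ultimately show ?thesis unfolding has_chain_net_def by (intro exI[of _ ?P]) simp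
qed

text \<open>
  For a face in coordinate \<open>k\<close> the weights over \<open>{..j}\<close> add up to less than \<open>1\<close>, because some digit leaves the
  face. This strict inequality survives a slight decrease of the \<open>j\<close>-th exponent. For \<open>i < j\<close> the exponents on
  \<open>{..i}\<close> are unchanged, and a sum of at most \<open>1\<close> is enough there.
\<close>
lemma chain_growth_without_island:
  assumes nd: "non_degenerated \<Lambda>" and no: "\<not> core True {..j}"
    and \<beta>: "\<And>i. weight_sum \<beta> D i = 1"
  obtains \<epsilon> where "0 < \<epsilon>" "growth has_chain_net (\<beta>(j := \<beta> j - \<epsilon>)) {..j}"
proof -
  let ?F = "{..j} \<times> {0, 1 :: real}"
  have FD: "face_digits k e \<subseteq> D" for k e by (auto simp: face_digits_def)
  have "\<forall>f\<in>?F. \<forall>\<^sub>F \<epsilon> in at_right 0. weight_sum (\<beta>(j := \<beta> j - \<epsilon>)) (face_digits (fst f) (snd f)) j < 1"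
  proof
    fix f assume f: "f \<in> ?F"
    have "weight_sum \<beta> (face_digits (fst f) (snd f)) j < 1"
      using weight_sum_face_less[OF nd, of "snd f" "fst f" j \<beta>] f \<beta>[of j] by auto
    then show "\<forall>\<^sub>F \<epsilon> in at_right 0. weight_sum (\<beta>(j := \<beta> j - \<epsilon>)) (face_digits (fst f) (snd f)) j < 1"
      by (rule order_tendstoD(2)[OF tendsto_weight_sum[OF FD]])
  qed
  then have "\<forall>\<^sub>F \<epsilon> in at_right 0. \<forall>f\<in>?F. weight_sum (\<beta>(j := \<beta> j - \<epsilon>)) (face_digits (fst f) (snd f)) j < 1"
    by (intro eventually_ball_finite) auto
  then have "\<forall>\<^sub>F \<epsilon> in at_right (0::real). 0 < \<epsilon> \<and>
      (\<forall>f\<in>?F. weight_sum (\<beta>(j := \<beta> j - \<epsilon>)) (face_digits (fst f) (snd f)) j < 1)"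
    using eventually_at_right_less[of "0::real"] by (rule eventually_conj[rotated])
  then obtain \<epsilon> :: real where \<epsilon>: "0 < \<epsilon>"
    "\<forall>f\<in>?F. weight_sum (\<beta>(j := \<beta> j - \<epsilon>)) (face_digits (fst f) (snd f)) j < 1"
    by - (drule eventually_happens'[OF trivial_limit_at_right_real], elim exE conjE, rule that)
  define \<gamma> where "\<gamma> = \<beta>(j := \<beta> j - \<epsilon>)"
  have faces: "growth (has_net (face k e)) \<gamma> {..j}" if k: "k \<le> j" and e: "e \<in> {0, 1}" for k e
  proof (rule net_growth[OF FD _ face_subset[OF e]])
    show "face k e \<subseteq> \<Lambda>" by (auto simp: face_def)
    show "initial {..j}" by (auto simp: initial_def)
    fix i assume i: "i \<in> {..j}"
    show "weight_sum \<gamma> (face_digits k e) i \<le> 1"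
    proof (cases "i = j")
      case True
      then show ?thesis using \<epsilon>(2) k e by (fastforce simp: \<gamma>_def intro: less_imp_le)
    next
      case False
      then have "digit_weight \<gamma> {..i} b = digit_weight \<beta> {..i} b" for b
        unfolding digit_weight_def \<gamma>_def using i by (intro prod.cong) auto
      then have "weight_sum \<gamma> (face_digits k e) i = weight_sum \<beta> (face_digits k e) i"
        by (simp add: weight_sum_def)
      then show ?thesis using weight_sum_subset[OF FD, of \<beta> k e i] \<beta>[of i] by simp
    qed
  qed
  have "growth has_chain_net \<gamma> {..j}"
    unfolding growth_def
  proof (intro allI impI)
    fix L :: real assume L: "0 < L"
    have "\<forall>f\<in>?F. \<exists>C>0. \<forall>\<sigma>. state \<sigma> \<and> (\<forall>k\<in>{..j}. L \<le> \<sigma> k) \<longrightarrow>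
        has_net (face (fst f) (snd f)) {..j} \<sigma> (C * pot \<gamma> {..j} \<sigma>)"
      using faces L unfolding growth_def by auto
    then obtain C where C: "\<And>f. f \<in> ?F \<Longrightarrow> 0 < C f"
      "\<And>f \<sigma>. f \<in> ?F \<Longrightarrow> state \<sigma> \<Longrightarrow> \<forall>k\<in>{..j}. L \<le> \<sigma> k \<Longrightarrow>
        has_net (face (fst f) (snd f)) {..j} \<sigma> (C f * pot \<gamma> {..j} \<sigma>)"
      by metis
    have "has_chain_net {..j} \<sigma> (sum C ?F * pot \<gamma> {..j} \<sigma>)"
      if \<sigma>: "state \<sigma>" "\<forall>k\<in>{..j}. L \<le> \<sigma> k" for \<sigma>
    proof -
      have "has_chain_net {..j} \<sigma> (\<Sum>f\<in>?F. C f * pot \<gamma> {..j} \<sigma>)"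
        using C(2)[OF _ \<sigma>] by (intro has_chain_net_of_faces[OF no \<sigma>(1)]) force
      then show ?thesis by (simp add: sum_distrib_right)
    qed
    moreover have "0 < sum C ?F" using C(1) by (intro sum_pos) auto
    ultimately show "\<exists>C>0. \<forall>\<sigma>. state \<sigma> \<and> (\<forall>k\<in>{..j}. L \<le> \<sigma> k) \<longrightarrow> has_chain_net {..j} \<sigma> (C * pot \<gamma> {..j} \<sigma>)"
      by blast
  qed
  then show ?thesis using that \<epsilon>(1) by (simp add: \<gamma>_def)
qed

text \<open>
  Let \<open>l\<close> be the coordinate after \<open>j\<close>. Decreasing the \<open>j\<close>-th exponent by \<open>\<epsilon>\<close> alone would raise the weight
  sums for the larger sets of coordinates above \<open>1\<close>. Increasing the \<open>l\<close>-th exponent by \<open>\<epsilon> - \<eta>\<close> compensates: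
  as the ratios in coordinate \<open>l\<close> are strictly smaller, an increase by slightly less than \<open>\<epsilon>\<close> suffices, and
  \<open>\<eta>\<close> is the gain in the total exponent.
\<close>
lemma smaller_exponent_without_island:
  assumes nd: "non_degenerated \<Lambda>" and no: "\<not> core True {..j}"
    and \<beta>: "\<And>i. weight_sum \<beta> D i = 1"
  shows "\<exists>\<gamma>. growth has_chain_net \<gamma> UNIV \<and> sum \<gamma> UNIV < sum \<beta> UNIV"
proof -
  obtain \<epsilon> where \<epsilon>: "0 < \<epsilon>" "growth has_chain_net (\<beta>(j := \<beta> j - \<epsilon>)) {..j}"
    using chain_growth_without_island[OF nd no \<beta>] by blast
  have sum_upd: "sum (\<gamma>(i := \<gamma> i + x)) UNIV = sum \<gamma> UNIV + x" for \<gamma> :: "'n \<Rightarrow> real" and i x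
  proof -
    have "sum (\<gamma>(i := \<gamma> i + x)) UNIV = (\<Sum>k\<in>UNIV. \<gamma> k + (if k = i then x else 0))"
      by (intro sum.cong) auto
    then show ?thesis by (simp add: sum.distrib)
  qed
  show ?thesis
  proof (cases "{..j} = UNIV")
    case True
    then show ?thesis using \<epsilon> sum_upd[of \<beta> j "- \<epsilon>"] by (intro exI[of _ "\<beta>(j := \<beta> j - \<epsilon>)"]) simp
  next
    case False
    define l where "l = Min {k. j < k}"
    have ne: "{k. j < k} \<noteq> {}" using False by (auto simp: not_le)
    have l: "j < l" "\<And>i. j < i \<Longrightarrow> l \<le> i"
      unfolding l_def using Min_in[of "{k. j < k}"] ne by auto
    have "\<forall>a\<in>D. \<forall>\<^sub>F \<eta> in at_right 0. r l (a l) powr (\<epsilon> - \<eta>) < r j (a j) powr \<epsilon>"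
    proof
      fix a assume a: "a \<in> D"
      have "((\<lambda>\<eta>. r l (a l) powr (\<epsilon> - \<eta>)) \<longlongrightarrow> r l (a l) powr (\<epsilon> - 0)) (at_right 0)"
        by (intro tendsto_intros) (use ratio_pos[OF a, of l] in auto)
      moreover have "r l (a l) powr (\<epsilon> - 0) < r j (a j) powr \<epsilon>"
        using ratio_strict_antimono[OF a l(1)] ratio_pos[OF a, of l] \<epsilon>(1) by (simp add: powr_less_mono2)
      ultimately show "\<forall>\<^sub>F \<eta> in at_right 0. r l (a l) powr (\<epsilon> - \<eta>) < r j (a j) powr \<epsilon>"
        by (rule order_tendstoD(2))
    qed
    then have "\<forall>\<^sub>F \<eta> in at_right 0. \<forall>a\<in>D. r l (a l) powr (\<epsilon> - \<eta>) < r j (a j) powr \<epsilon>"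
      using finite_digits by (intro eventually_ball_finite) auto
    then have "\<forall>\<^sub>F \<eta> in at_right (0::real). 0 < \<eta> \<and> (\<forall>a\<in>D. r l (a l) powr (\<epsilon> - \<eta>) < r j (a j) powr \<epsilon>)"
      using eventually_at_right_less[of "0::real"] by (rule eventually_conj[rotated])
    then obtain \<eta> :: real where \<eta>: "0 < \<eta>" "\<forall>a\<in>D. r l (a l) powr (\<epsilon> - \<eta>) < r j (a j) powr \<epsilon>"
      by - (drule eventually_happens'[OF trivial_limit_at_right_real], elim exE conjE, rule that)
    define \<gamma> where "\<gamma> = \<beta>(j := \<beta> j + - \<epsilon>)"
    define \<gamma>' where "\<gamma>' = \<gamma>(l := \<gamma> l + (\<epsilon> - \<eta>))"
    have "pot \<gamma>' {..j} \<sigma> = pot \<gamma> {..j} \<sigma>" for \<sigma>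
      unfolding pot_def \<gamma>'_def using l(1) by (intro prod.cong) auto
    then have base: "growth has_chain_net \<gamma>' {..j}" using \<epsilon>(2) by (simp add: growth_def \<gamma>_def)
    have "growth has_chain_net \<gamma>' UNIV"
    proof (rule chain_net_growth[OF _ base])
      show "initial {..j}" "initial UNIV" by (auto simp: initial_def)
      fix i assume "i \<in> UNIV - {..j}"
      then have i: "j \<le> i" "l \<le> i" using l(2) by auto
      have "digit_weight \<gamma>' {..i} a \<le> digit_weight \<beta> {..i} a" if a: "a \<in> D" for a
      proof -
        have "r j (a j) powr (- \<epsilon>) * r l (a l) powr (\<epsilon> - \<eta>) \<le> r j (a j) powr (- \<epsilon>) * r j (a j) powr \<epsilon>"
          using \<eta>(2) a by (intro mult_left_mono) (auto intro: less_imp_le)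
        also have "\<dots> = 1" using ratio_pos[OF a, of j] by (simp add: powr_minus)
        finally have "digit_weight \<beta> {..i} a * (r j (a j) powr (- \<epsilon>) * r l (a l) powr (\<epsilon> - \<eta>)) \<le> digit_weight \<beta> {..i} a * 1"
          using digit_weight_pos[OF a, of \<beta> "{..i}"] by (intro mult_left_mono) auto
        then show ?thesis
          unfolding \<gamma>'_def \<gamma>_def digit_weight_update[OF a] using i by (simp add: mult.assoc)
      qed
      then show "weight_sum \<gamma>' D i \<le> 1" using weight_sum_mono[of D \<gamma>' i \<beta>] \<beta>[of i] by simp
    qed simp
    moreover have "sum \<gamma>' UNIV < sum \<beta> UNIV"
      unfolding \<gamma>'_def \<gamma>_def sum_upd using \<eta>(1) by simp
    ultimately show ?thesis by blast
  qed
qed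

section \<open>Cylinders have positive measure\<close>

lemma dist_\<phi>_le:
  assumes "a \<in> D" shows "dist (\<phi> a x) (\<phi> a y) \<le> ratio_max * dist x y"
proof -
  have "norm (\<phi> a x - \<phi> a y) \<le> norm (ratio_max *\<^sub>R (x - y))"
  proof (rule norm_le_componentwise_cart)
    fix k
    show "norm ((\<phi> a x - \<phi> a y) $ k) \<le> norm ((ratio_max *\<^sub>R (x - y)) $ k)"
      using mult_right_mono[OF ratio_max_ge[OF assms], of "\<bar>x $ k - y $ k\<bar>" k] ratio_max_pos
      by (simp add: abs_\<phi>_diff[OF assms] abs_mult)
  qed
  then show ?thesis using ratio_max_pos by (simp add: dist_norm)
qed

lemma dist_word_map_le: "set w \<subseteq> D \<Longrightarrow> dist (word_map w x) (word_map w y) \<le> dist x y"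
proof (induction w)
  case (Cons a w)
  have "dist (word_map (a # w) x) (word_map (a # w) y) \<le> ratio_max * dist (word_map w x) (word_map w y)"
    using dist_\<phi>_le Cons.prems by simp
  also have "\<dots> \<le> 1 * dist (word_map w x) (word_map w y)"
    using ratio_max_less_1 by (intro mult_right_mono) auto
  finally show ?case using Cons by simp
qed simp

lemma continuous_\<phi>: "continuous (at x) (\<phi> a)" and continuous_on_\<phi>: "continuous_on S (\<phi> a)"
proof -
  have *: "continuous_on S (\<phi> a)" for S
    unfolding diag_map_def coord_map_def by (intro continuous_intros)
  then show "continuous_on S (\<phi> a)" .
  show "continuous (at x) (\<phi> a)" using *[of UNIV] continuous_on_eq_continuous_at[OF open_UNIV] by blast
qed

text \<open>
  By invariance the mass of the \<open>\<epsilon>\<close>-neighbourhood of the sponge is at most that of the neighbourhood of radius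
  \<open>ratio_max * \<epsilon>\<close>. Iterating, all neighbourhoods have at most the mass of the sponge itself, and large ones
  have positive mass.
\<close>
lemma measure_sponge_pos:
  fixes \<mu> :: "(real, 'n) vec measure"
  assumes "prob_space \<mu>" and sets: "sets \<mu> = sets borel" and p: "\<And>a. a \<in> D \<Longrightarrow> 0 \<le> p a"
    and inv: "\<And>B. B \<in> sets borel \<Longrightarrow> measure \<mu> B = (\<Sum>a\<in>D. p a * measure \<mu> (\<phi> a -` B))"
  shows "0 < measure \<mu> \<Lambda>"
proof -
  interpret prob_space \<mu> by fact
  have space: "space \<mu> = UNIV" using sets_eq_imp_space_eq[OF sets] by simp
  have sum_p: "(\<Sum>a\<in>D. p a) = 1" using inv[of UNIV] prob_space by (simp add: space)
  define N where "N \<epsilon> = {x. infdist x \<Lambda> \<le> \<epsilon>}" for \<epsilon>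
  have closed_N: "closed (N \<epsilon>)" for \<epsilon>
    unfolding N_def by (intro closed_Collect_le continuous_intros)
  have N_sets: "N \<epsilon> \<in> sets \<mu>" for \<epsilon> using closed_N by (simp add: sets borel_closed)
  have step: "measure \<mu> (N \<epsilon>) \<le> measure \<mu> (N (ratio_max * \<epsilon>))" for \<epsilon>
  proof -
    have "N \<epsilon> \<subseteq> \<phi> a -` N (ratio_max * \<epsilon>)" if a: "a \<in> D" for a
    proof
      fix x assume x: "x \<in> N \<epsilon>"
      obtain y where y: "y \<in> \<Lambda>" "infdist x \<Lambda> = dist x y"
        using infdist_attains_inf[OF compact_imp_closed[OF compact_sponge] sponge_nonempty] by metis
      have "infdist (\<phi> a x) \<Lambda> \<le> dist (\<phi> a x) (\<phi> a y)" using \<phi>_in_sponge[OF a y(1)] by (rule infdist_le)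
      also have "\<dots> \<le> ratio_max * dist x y" by (rule dist_\<phi>_le[OF a])
      also have "\<dots> \<le> ratio_max * \<epsilon>"
        using x y(2) ratio_max_pos by (intro mult_left_mono) (auto simp: N_def)
      finally show "x \<in> \<phi> a -` N (ratio_max * \<epsilon>)" by (simp add: N_def)
    qed
    moreover have "\<phi> a -` N (ratio_max * \<epsilon>) \<in> sets \<mu>" for a
      using continuous_closed_vimage[OF closed_N continuous_\<phi>] by (simp add: sets borel_closed)
    ultimately have "measure \<mu> (N \<epsilon>) \<le> measure \<mu> (\<phi> a -` N (ratio_max * \<epsilon>))" if "a \<in> D" for a
      using that by (intro finite_measure_mono) auto
    then have "(\<Sum>a\<in>D. p a * measure \<mu> (N \<epsilon>)) \<le> (\<Sum>a\<in>D. p a * measure \<mu> (\<phi> a -` N (ratio_max * \<epsilon>)))"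
      using p by (intro sum_mono mult_left_mono)
    also have "\<dots> = measure \<mu> (N (ratio_max * \<epsilon>))"
      using inv[of "N (ratio_max * \<epsilon>)"] closed_N by (simp add: borel_closed)
    finally show ?thesis using sum_p by (simp flip: sum_distrib_right)
  qed
  have iterate: "measure \<mu> (N \<epsilon>) \<le> measure \<mu> (N (ratio_max ^ m * \<epsilon>))" for \<epsilon> m
  proof (induction m)
    case (Suc m)
    then show ?case using step[of "ratio_max ^ m * \<epsilon>"] by (simp add: mult.assoc)
  qed simp
  have inter: "(\<Inter>m. N (ratio_max ^ m * \<epsilon>)) = \<Lambda>" if \<epsilon>: "0 < \<epsilon>" for \<epsilon>
  proof -
    have "infdist x \<Lambda> = 0" if x: "\<And>m. infdist x \<Lambda> \<le> ratio_max ^ m * \<epsilon>" for x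
    proof -
      have "(\<lambda>m. ratio_max ^ m * \<epsilon>) \<longlonglongrightarrow> 0 * \<epsilon>"
        using ratio_max_pos ratio_max_less_1 by (intro tendsto_mult LIMSEQ_realpow_zero tendsto_const) auto
      then have "infdist x \<Lambda> \<le> 0" using x by (intro LIMSEQ_le_const) auto
      then show ?thesis using infdist_nonneg[of x \<Lambda>] by simp
    qed
    then have "(\<Inter>m. N (ratio_max ^ m * \<epsilon>)) \<subseteq> {x. infdist x \<Lambda> = 0}" by (auto simp: N_def)
    moreover have "{x. infdist x \<Lambda> = 0} = \<Lambda>"
      using in_closed_iff_infdist_zero[OF compact_imp_closed[OF compact_sponge] sponge_nonempty] by blast
    moreover have "\<Lambda> \<subseteq> (\<Inter>m. N (ratio_max ^ m * \<epsilon>))"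
      using \<epsilon> ratio_max_pos by (auto simp: N_def)
    ultimately show ?thesis by blast
  qed
  have decseq: "decseq (\<lambda>m. N (ratio_max ^ m * \<epsilon>))" if \<epsilon>: "0 < \<epsilon>" for \<epsilon>
  proof (rule decseq_SucI, rule subsetI)
    fix m x assume "x \<in> N (ratio_max ^ Suc m * \<epsilon>)"
    moreover have "ratio_max ^ Suc m * \<epsilon> \<le> ratio_max ^ m * \<epsilon>"
      using \<epsilon> ratio_max_pos ratio_max_less_1 by (intro mult_right_mono power_decreasing) auto
    ultimately show "x \<in> N (ratio_max ^ m * \<epsilon>)" unfolding N_def by simp
  qed
  have le: "measure \<mu> (N \<epsilon>) \<le> measure \<mu> \<Lambda>" if \<epsilon>: "0 < \<epsilon>" for \<epsilon>
  proof (rule LIMSEQ_le_const)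
    have "range (\<lambda>m. N (ratio_max ^ m * \<epsilon>)) \<subseteq> sets \<mu>" using N_sets by auto
    then show "(\<lambda>m. measure \<mu> (N (ratio_max ^ m * \<epsilon>))) \<longlonglongrightarrow> measure \<mu> \<Lambda>"
      using finite_Lim_measure_decseq[OF _ decseq[OF \<epsilon>]] inter[OF \<epsilon>] by simp
    show "\<exists>N0. \<forall>m\<ge>N0. measure \<mu> (N \<epsilon>) \<le> measure \<mu> (N (ratio_max ^ m * \<epsilon>))" using iterate by blast
  qed
  have "(\<Union>m. N (real m)) = UNIV" using real_arch_simple by (auto simp: N_def)
  moreover have "incseq (\<lambda>m. N (real m))" by (auto simp: incseq_def N_def)
  ultimately have "(\<lambda>m. measure \<mu> (N (real m))) \<longlonglongrightarrow> 1"
    using finite_Lim_measure_incseq[of "\<lambda>m. N (real m)"] N_sets prob_space by (simp add: space image_subset_iff)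
  then have "\<forall>\<^sub>F m in sequentially. 0 < measure \<mu> (N (real m)) \<and> 0 < m"
    by (intro eventually_conj order_tendstoD(1) eventually_gt_at_top) auto
  then obtain m where "0 < measure \<mu> (N (real m))" "0 < m"
    by (metis (mono_tags, lifting) eventually_happens' sequentially_bot)
  then show ?thesis using le[of "real m"] by simp
qed

lemma measure_cylinder_pos:
  fixes \<mu> :: "(real, 'n) vec measure"
  assumes "prob_space \<mu>" and sets: "sets \<mu> = sets borel" and p: "\<And>a. a \<in> D \<Longrightarrow> 0 < p a"
    and inv: "\<And>B. B \<in> sets borel \<Longrightarrow> measure \<mu> B = (\<Sum>a\<in>D. p a * measure \<mu> (\<phi> a -` B))"
    and w: "set w \<subseteq> D"
  shows "0 < measure \<mu> (word_map w ` \<Lambda>)"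
  using w
proof (induction w)
  case Nil
  then show ?case using measure_sponge_pos[OF assms(1) sets less_imp_le[OF p] inv] by (simp add: image_def)
next
  case (Cons a w)
  interpret prob_space \<mu> by fact
  let ?R = "word_map w ` \<Lambda>"
  have compact_word: "compact (word_map v ` \<Lambda>)" for v
  proof (induction v)
    case Nil then show ?case using compact_sponge by (simp add: image_def)
  next
    case (Cons b v)
    then have "compact (\<phi> b ` word_map v ` \<Lambda>)" by (rule compact_continuous_image[OF continuous_on_\<phi>])
    moreover have "\<phi> b ` word_map v ` \<Lambda> = word_map (b # v) ` \<Lambda>" by (auto simp: image_image)
    ultimately show ?case by metis
  qed
  have closed: "closed (word_map (a # w) ` \<Lambda>)" by (rule compact_imp_closed[OF compact_word])
  have a: "a \<in> D" using Cons.prems by simp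
  have "?R \<subseteq> \<phi> a -` (word_map (a # w) ` \<Lambda>)" by auto
  then have "measure \<mu> ?R \<le> measure \<mu> (\<phi> a -` (word_map (a # w) ` \<Lambda>))"
    using continuous_closed_vimage[OF closed continuous_\<phi>]
    by (intro finite_measure_mono) (auto simp: sets borel_closed)
  then have "0 < p a * measure \<mu> (\<phi> a -` (word_map (a # w) ` \<Lambda>))"
    using Cons p[OF a] by simp
  also have "\<dots> \<le> (\<Sum>b\<in>D. p b * measure \<mu> (\<phi> b -` (word_map (a # w) ` \<Lambda>)))"
    using a finite_digits by (intro member_le_sum) (auto intro!: mult_nonneg_nonneg less_imp_le[OF p])
  also have "\<dots> = measure \<mu> (word_map (a # w) ` \<Lambda>)"
    using inv closed by (simp add: borel_closed)
  finally show ?case .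
qed

section \<open>Counting at a given scale\<close>

lemma state_const: "0 < s \<Longrightarrow> state (\<lambda>_. s)"
  by (auto simp: state_def intro: monotoneI)

lemma pot_const: "0 < s \<Longrightarrow> pot \<gamma> UNIV (\<lambda>_. s) = s powr sum \<gamma> UNIV"
  by (simp add: pot_def powr_sum)

lemma dist_le_of_close:
  assumes \<delta>: "0 < \<delta>" and "close UNIV (\<lambda>_. real CARD('n) / \<delta>) x y"
  shows "dist x y \<le> \<delta>"
proof -
  have "\<bar>(x - y) $ k\<bar> \<le> \<delta> / real CARD('n)" for k
    using assms by (simp add: close_def field_simps)
  then have "norm (x - y) \<le> (\<Sum>k\<in>(UNIV :: 'n set). \<delta> / real CARD('n))"
    by (intro order_trans[OF norm_le_l1_cart] sum_mono)
  then show ?thesis by (simp add: dist_norm)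
qed

text \<open>
  The factor \<open>CARD('n)\<close> in the scaled side makes points that are close in each coordinate \<open>\<delta>\<close>-close in the
  Euclidean distance.
\<close>
lemma growth_at_scale:
  assumes "growth cnt \<gamma> UNIV"
  obtains C where "0 < C"
    "\<And>\<delta>. 0 < \<delta> \<Longrightarrow> \<delta> < 1 \<Longrightarrow> cnt UNIV (\<lambda>_. real CARD('n) / \<delta>) (C * \<delta> powr (- sum \<gamma> UNIV))"
proof -
  obtain C where C: "0 < C" "\<forall>\<sigma>. state \<sigma> \<and> (\<forall>k\<in>UNIV. 1 \<le> \<sigma> k) \<longrightarrow> cnt UNIV \<sigma> (C * pot \<gamma> UNIV \<sigma>)"
    using assms unfolding growth_def by (metis zero_less_one)
  define C' where "C' = C * real CARD('n) powr sum \<gamma> UNIV"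
  have "cnt UNIV (\<lambda>_. real CARD('n) / \<delta>) (C' * \<delta> powr (- sum \<gamma> UNIV))" if \<delta>: "0 < \<delta>" "\<delta> < 1" for \<delta>
  proof -
    have ge: "1 \<le> real CARD('n)" by (simp add: Suc_leI)
    then have "\<delta> \<le> real CARD('n)" using \<delta> by linarith
    then have "1 \<le> real CARD('n) / \<delta>" using \<delta> by (simp add: field_simps)
    moreover have "pot \<gamma> UNIV (\<lambda>_. real CARD('n) / \<delta>) = real CARD('n) powr sum \<gamma> UNIV * \<delta> powr (- sum \<gamma> UNIV)"
      using \<delta> by (subst pot_const) (auto intro!: divide_powr)
    ultimately show ?thesis
      using C(2)[rule_format, of "\<lambda>_. real CARD('n) / \<delta>"] \<delta> by (simp add: state_const C'_def mult.assoc)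
  qed
  moreover have "0 < C'" using C(1) by (simp add: C'_def)
  ultimately show ?thesis using that by blast
qed

text \<open>
  The maps do not increase distances, so they carry a chain net of the sponge to a chain net of the cylinder with
  the same \<open>\<delta>\<close>.
\<close>
lemma components_of_cylinder_le:
  assumes \<delta>: "0 < \<delta>" and net: "has_chain_net UNIV (\<lambda>_. real CARD('n) / \<delta>) m" and w: "set w \<subseteq> D"
  shows "finite ((word_map w ` \<Lambda>) // (chain_step (word_map w ` \<Lambda>) \<delta>)\<^sup>*)"
    "real (num_components (word_map w ` \<Lambda>) \<delta>) \<le> m"
proof -
  let ?E = "word_map w ` \<Lambda>"
  obtain P where P: "finite P" "real (card P) \<le> m"
    "\<forall>x\<in>\<Lambda>. \<exists>p\<in>P. (x, p) \<in> (link UNIV (\<lambda>_. real CARD('n) / \<delta>))\<^sup>*"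
    using net unfolding has_chain_net_def by blast
  have "link UNIV (\<lambda>_. real CARD('n) / \<delta>) \<subseteq> chain_step \<Lambda> \<delta>"
    using dist_le_of_close[OF \<delta>] by (auto simp: link_def chain_step_def)
  then have sub: "(link UNIV (\<lambda>_. real CARD('n) / \<delta>))\<^sup>* \<subseteq> (chain_step \<Lambda> \<delta>)\<^sup>*" by (rule rtrancl_mono)
  have "\<exists>q\<in>word_map w ` P. (y, q) \<in> (chain_step ?E \<delta>)\<^sup>*" if y: "y \<in> ?E" for y
  proof -
    obtain x where x: "x \<in> \<Lambda>" "y = word_map w x" using y by blast
    then obtain p where p: "p \<in> P" "(x, p) \<in> (chain_step \<Lambda> \<delta>)\<^sup>*" using P(3) sub by blast
    then show ?thesis using chain_image[OF dist_word_map_le[OF w] p(2)] x(2) by blast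
  qed
  note bound = components_le_chain_net[OF finite_imageI[OF P(1)] this]
  then show "finite (?E // (chain_step ?E \<delta>)\<^sup>*)" by blast
  have "num_components ?E \<delta> \<le> card P" using bound(2) card_image_le[OF P(1)] by (meson order_trans)
  then show "real (num_components ?E \<delta>) \<le> m" using P(2) by linarith
qed

text \<open>
  Specialisation to the state whose sides are all equal to \<open>s\<close>, which is the whole cube seen at scale \<open>1 / s\<close>.
\<close>
lemma separated_at_scale:
  assumes "separated_growth rigid \<gamma> UNIV"
  obtains c \<kappa> where "0 < c" "0 < \<kappa>"
    "\<And>s. 1 \<le> s \<Longrightarrow> \<exists>\<V>. separated rigid UNIV (\<lambda>_. s) c \<V> \<and> \<kappa> * s powr sum \<gamma> UNIV \<le> real (card \<V>)"
proof -
  obtain c \<kappa> where c: "0 < c" "0 < \<kappa>" "\<forall>\<sigma>. state \<sigma> \<and> (\<forall>k\<in>UNIV. 1 \<le> \<sigma> k) \<longrightarrow>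
      (\<exists>\<V>. separated rigid UNIV \<sigma> c \<V> \<and> \<kappa> * pot \<gamma> UNIV \<sigma> \<le> real (card \<V>))"
    using assms[unfolded separated_growth_def, rule_format, OF zero_less_one]
    by (elim exE conjE) (rule that)
  have "\<exists>\<V>. separated rigid UNIV (\<lambda>_. s) c \<V> \<and> \<kappa> * s powr sum \<gamma> UNIV \<le> real (card \<V>)" if "1 \<le> s" for s
    using c(3)[rule_format, of "\<lambda>_. s"] that by (simp add: state_const pot_const)
  then show ?thesis using that c(1,2) by blast
qed

lemma dist_ge_of_apart:
  assumes "0 < s" "apart UNIV (\<lambda>_. s) c x y"
  shows "c / s \<le> dist x y"
proof -
  obtain k where "c \<le> s * \<bar>x $ k - y $ k\<bar>" using assms by (auto simp: apart_def)
  also have "\<dots> \<le> s * dist x y"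
    using component_le_norm_cart[of "x - y" k] assms(1) by (intro mult_left_mono) (auto simp: dist_norm)
  finally show ?thesis using assms(1) by (simp add: field_simps)
qed

lemma box_dim_sponge:
  assumes nd: "non_degenerated \<Lambda>" and \<beta>: "\<And>i. weight_sum \<beta> D i = 1"
  shows "box_dim \<Lambda> = sum \<beta> UNIV"
proof -
  let ?s = "sum \<beta> UNIV"
  have init: "initial (UNIV :: 'n set)" by (auto simp: initial_def)
  have "growth (has_net \<Lambda>) \<beta> UNIV"
    using net_growth[of D \<Lambda>, OF order_refl order_refl _ init] sponge_eq \<beta> by simp
  then obtain C where C: "0 < C"
    "\<And>\<delta>. 0 < \<delta> \<Longrightarrow> \<delta> < 1 \<Longrightarrow> has_net \<Lambda> UNIV (\<lambda>_. real CARD('n) / \<delta>) (C * \<delta> powr (- ?s))"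
    using growth_at_scale by blast
  have net: "\<exists>P. finite P \<and> real (card P) \<le> C * \<delta> powr (- ?s) \<and> (\<forall>x\<in>\<Lambda>. \<exists>p\<in>P. dist x p \<le> \<delta>)"
    if \<delta>: "0 < \<delta>" "\<delta> < 1" for \<delta>
  proof -
    obtain P where P: "finite P" "real (card P) \<le> C * \<delta> powr (- ?s)"
      "\<forall>x\<in>\<Lambda>. \<exists>p\<in>P. close UNIV (\<lambda>_. real CARD('n) / \<delta>) x p"
      using C(2)[OF \<delta>] unfolding has_net_def by (elim exE conjE) (rule that)
    have "\<forall>x\<in>\<Lambda>. \<exists>p\<in>P. dist x p \<le> \<delta>" using P(3) dist_le_of_close[OF \<delta>(1)] by blast
    then show ?thesis using P(1,2) by (intro exI[of _ P] conjI)
  qed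
  obtain c \<kappa> where c: "0 < c" "0 < \<kappa>"
    "\<And>s. 1 \<le> s \<Longrightarrow> \<exists>\<V>. separated False UNIV (\<lambda>_. s) c \<V> \<and> \<kappa> * s powr ?s \<le> real (card \<V>)"
    using separated_at_scale[OF separated_growth[OF init core_of_non_degenerated[OF nd] \<beta>]] by blast
  have lower: "\<kappa> * (c / 3) powr ?s * \<delta> powr (- ?s) \<le> real (covering_number \<Lambda> \<delta>)"
    if \<delta>: "0 < \<delta>" "\<delta> < min 1 (c / 3)" for \<delta>
  proof -
    \<comment> \<open>At this scale the separation constant \<open>c\<close> means distance \<open>3 * \<delta>\<close>, more than the diameter of a ball of radius \<open>\<delta>\<close>.\<close>
    define s where "s = c / 3 / \<delta>"
    have s: "1 \<le> s" "0 < s" "c / s = 3 * \<delta>" using \<delta> c(1) by (auto simp: s_def field_simps)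
    obtain \<V> where \<V>: "separated False UNIV (\<lambda>_. s) c \<V>" "\<kappa> * s powr ?s \<le> real (card \<V>)"
      using c(3)[OF s(1)] by blast
    have VL: "V \<noteq> {}" "V \<subseteq> \<Lambda>" if "V \<in> \<V>" for V using \<V>(1) that by (auto simp: separated_def)
    obtain p where p: "\<And>V. V \<in> \<V> \<Longrightarrow> p V \<in> V" using VL by (metis ex_in_conv)
    have far: "2 * \<delta> < dist (p V) (p W)" if "V \<in> \<V>" "W \<in> \<V>" "V \<noteq> W" for V W
    proof -
      have "disjnt V W" using \<V>(1) that by (auto simp: separated_def pairwise_def)
      then have "p W \<notin> V" using p[OF that(2)] by (auto simp: disjnt_def)
      then have "apart UNIV (\<lambda>_. s) c (p V) (p W)"
      proof -
        have "p W \<in> rivals False \<V> - V" using \<open>p W \<notin> V\<close> p[OF that(2)] that(2) by (auto simp: rivals_def)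
        then show ?thesis using \<V>(1) p[OF that(1)] that(1) unfolding separated_def by blast
      qed
      then show ?thesis using dist_ge_of_apart[OF s(2)] s(3) \<delta> by fastforce
    qed
    have "inj_on p \<V>"
    proof (rule inj_onI, rule ccontr)
      fix V W assume "V \<in> \<V>" "W \<in> \<V>" "p V = p W" "V \<noteq> W"
      then show False using far[of V W] \<delta> by simp
    qed
    then have "card \<V> = card (p ` \<V>)" by (simp add: card_image)
    also have "\<dots> \<le> covering_number \<Lambda> \<delta>"
    proof -
      obtain P where P: "finite P" "\<forall>x\<in>\<Lambda>. \<exists>p\<in>P. dist x p \<le> \<delta>" using net[of \<delta>] \<delta> by auto
      show ?thesis
      proof (rule covering_number_ge[OF P(1)])
        show "\<exists>q\<in>P. dist x q \<le> \<delta>" if "x \<in> \<Lambda>" for x using P(2) that by blast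
        show "p ` \<V> \<subseteq> \<Lambda>" using p VL by blast
        show "2 * \<delta> < dist x y" if "x \<in> p ` \<V>" "y \<in> p ` \<V>" "x \<noteq> y" for x y using far that by blast
      qed
    qed
    finally have "\<kappa> * s powr ?s \<le> real (covering_number \<Lambda> \<delta>)" using \<V>(2) by linarith
    moreover have "s powr ?s = (c / 3) powr ?s * \<delta> powr (- ?s)"
      unfolding s_def using \<delta> c(1) by (intro divide_powr) auto
    ultimately show ?thesis by (simp add: mult.assoc)
  qed
  show ?thesis
  proof (rule box_dim_eqI[of "\<kappa> * (c / 3) powr ?s" C])
    show "\<forall>\<^sub>F \<delta> in at_right 0. \<kappa> * (c / 3) powr ?s * \<delta> powr (- ?s) \<le> real (covering_number \<Lambda> \<delta>)"
      by (rule eventually_mono[OF eventually_small[of "min 1 (c / 3)"]]) (use c(1) lower in auto)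
    show "\<forall>\<^sub>F \<delta> in at_right 0. real (covering_number \<Lambda> \<delta>) \<le> C * \<delta> powr (- ?s)"
    proof (rule eventually_mono[OF eventually_small[of 1]])
      fix \<delta> :: real assume "0 < \<delta> \<and> \<delta> < 1"
      then obtain P where P: "finite P" "real (card P) \<le> C * \<delta> powr (- ?s)" "\<forall>x\<in>\<Lambda>. \<exists>p\<in>P. dist x p \<le> \<delta>"
        using net[of \<delta>] by blast
      then have "covering_number \<Lambda> \<delta> \<le> card P" by (intro covering_number_le) auto
      then show "real (covering_number \<Lambda> \<delta>) \<le> C * \<delta> powr (- ?s)" using P(2) by linarith
    qed simp
  qed (use c C in auto)
qed

lemma maximal_power_law_of_islands:
  assumes nd: "non_degenerated \<Lambda>" and \<beta>: "\<And>i. weight_sum \<beta> D i = 1"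
    and isl: "\<And>i. core True {..i}"
  shows "maximal_power_law \<Lambda>"
proof -
  let ?s = "sum \<beta> UNIV"
  have init: "initial (UNIV :: 'n set)" "initial ({} :: 'n set)" by (auto simp: initial_def)
  obtain x0 where "x0 \<in> \<Lambda>" using sponge_nonempty by blast
  then have "has_chain_net {} \<sigma> 1" for \<sigma>
    unfolding has_chain_net_def by (intro exI[of _ "{x0}"]) (auto simp: link_def close_def)
  then have "growth has_chain_net \<beta> {}" unfolding growth_def by (auto intro!: exI[of _ 1])
  then have "growth has_chain_net \<beta> UNIV"
    using chain_net_growth[OF init(2) _ init(1)] \<beta> by simp
  then obtain C where C: "0 < C"
    "\<And>\<delta>. 0 < \<delta> \<Longrightarrow> \<delta> < 1 \<Longrightarrow> has_chain_net UNIV (\<lambda>_. real CARD('n) / \<delta>) (C * \<delta> powr (- ?s))"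
    using growth_at_scale by blast
  have upper: "finite (\<Lambda> // (chain_step \<Lambda> \<delta>)\<^sup>*)" "real (num_components \<Lambda> \<delta>) \<le> C * \<delta> powr (- ?s)"
    if \<delta>: "0 < \<delta>" "\<delta> < 1" for \<delta>
    using components_of_cylinder_le[OF \<delta>(1) C(2)[OF \<delta>], of "[]"] by (simp_all add: image_def)
  obtain c \<kappa> where c: "0 < c" "0 < \<kappa>"
    "\<And>s. 1 \<le> s \<Longrightarrow> \<exists>\<V>. separated True UNIV (\<lambda>_. s) c \<V> \<and> \<kappa> * s powr ?s \<le> real (card \<V>)"
    using separated_at_scale[OF separated_growth[OF init(1) isl \<beta>]] by blast
  have lower: "\<kappa> * (c / 2) powr ?s * \<delta> powr (- ?s) \<le> real (num_components \<Lambda> \<delta>)"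
    if \<delta>: "0 < \<delta>" "\<delta> < min 1 (c / 2)" for \<delta>
  proof -
    \<comment> \<open>At this scale the separation constant \<open>c\<close> means distance \<open>2 * \<delta>\<close>, which no step of a chain can bridge.\<close>
    define s where "s = c / 2 / \<delta>"
    have s: "1 \<le> s" "0 < s" "c / s = 2 * \<delta>" using \<delta> c(1) by (auto simp: s_def field_simps)
    obtain \<V> where \<V>: "separated True UNIV (\<lambda>_. s) c \<V>" "\<kappa> * s powr ?s \<le> real (card \<V>)"
      using c(3)[OF s(1)] by blast
    have "card \<V> \<le> num_components \<Lambda> \<delta>"
    proof (rule components_ge_separated_pieces)
      show "finite (\<Lambda> // (chain_step \<Lambda> \<delta>)\<^sup>*)" using upper(1) \<delta> by simp
      show "disjoint \<V>" "\<And>V. V \<in> \<V> \<Longrightarrow> V \<noteq> {} \<and> V \<subseteq> \<Lambda>" using \<V>(1) by (auto simp: separated_def)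
      fix V x y assume "V \<in> \<V>" "x \<in> V" "y \<in> \<Lambda> - V"
      then have "apart UNIV (\<lambda>_. s) c x y" using \<V>(1) by (auto simp: separated_def rivals_def)
      then show "\<delta> < dist x y" using dist_ge_of_apart[OF s(2)] s(3) \<delta> by fastforce
    qed
    then have "\<kappa> * s powr ?s \<le> real (num_components \<Lambda> \<delta>)" using \<V>(2) by linarith
    moreover have "s powr ?s = (c / 2) powr ?s * \<delta> powr (- ?s)"
      unfolding s_def using \<delta> c(1) by (intro divide_powr) auto
    ultimately show ?thesis by (simp add: mult.assoc)
  qed
  show ?thesis
    unfolding maximal_power_law_def box_dim_sponge[OF nd \<beta>]
  proof (rule bigthetaI'[of "\<kappa> * (c / 2) powr ?s" C])
    show "\<forall>\<^sub>F \<delta> in at_right 0. \<kappa> * (c / 2) powr ?s * norm (\<delta> powr (- ?s)) \<le> norm (real (num_components \<Lambda> \<delta>)) \<and>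
        norm (real (num_components \<Lambda> \<delta>)) \<le> C * norm (\<delta> powr (- ?s))"
      by (rule eventually_mono[OF eventually_small[of "min 1 (c / 2)"]]) (use c(1) lower upper(2) in auto)
  qed (use c C in auto)
qed

text \<open>
  The exponent is nonnegative because there is always at least one component; this is what later makes
  the final exponent positive.
\<close>
lemma components_of_cylinders_bound:
  assumes nd: "non_degenerated \<Lambda>" and \<beta>: "\<And>i. weight_sum \<beta> D i = 1"
    and not_max: "\<not> maximal_power_law \<Lambda>"
  obtains \<theta> C where "0 \<le> \<theta>" "\<theta> < sum \<beta> UNIV" "0 < C"
    "\<And>\<delta> w. 0 < \<delta> \<Longrightarrow> \<delta> < 1 \<Longrightarrow> set w \<subseteq> D \<Longrightarrow>
      real (num_components (word_map w ` \<Lambda>) \<delta>) \<le> C * \<delta> powr (- \<theta>)"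
proof -
  obtain j where "\<not> core True {..j}" using maximal_power_law_of_islands[OF nd \<beta>] not_max by blast
  then obtain \<gamma> where \<gamma>: "growth has_chain_net \<gamma> UNIV" "sum \<gamma> UNIV < sum \<beta> UNIV"
    using smaller_exponent_without_island[OF nd _ \<beta>] by blast
  obtain C where C: "0 < C"
    "\<And>\<delta>. 0 < \<delta> \<Longrightarrow> \<delta> < 1 \<Longrightarrow> has_chain_net UNIV (\<lambda>_. real CARD('n) / \<delta>) (C * \<delta> powr (- sum \<gamma> UNIV))"
    using growth_at_scale[OF \<gamma>(1)] by blast
  have bound: "real (num_components (word_map w ` \<Lambda>) \<delta>) \<le> C * \<delta> powr (- sum \<gamma> UNIV)"
    if "0 < \<delta>" "\<delta> < 1" "set w \<subseteq> D" for \<delta> w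
    using components_of_cylinder_le(2)[OF that(1) C(2)[OF that(1,2)] that(3)] .
  have "0 \<le> sum \<gamma> UNIV"
  proof (rule ccontr)
    assume neg: "\<not> ?thesis"
    then have "0 < - sum \<gamma> UNIV" by simp
    then have "((\<lambda>\<delta>. C * \<delta> powr (- sum \<gamma> UNIV)) \<longlongrightarrow> 0) (at_right 0)"
      using tendsto_mult_powr_right_zero[of "- sum \<gamma> UNIV" C] by simp
    then have "\<forall>\<^sub>F \<delta> in at_right 0. C * \<delta> powr (- sum \<gamma> UNIV) < 1"
      by (rule order_tendstoD(2)) simp
    from eventually_conj[OF eventually_small[OF zero_less_one] this]
    have "\<forall>\<^sub>F \<delta> in at_right 0. (0 < \<delta> \<and> \<delta> < 1) \<and> C * \<delta> powr (- sum \<gamma> UNIV) < 1" .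
    then obtain \<delta> where \<delta>: "0 < \<delta>" "\<delta> < 1" "C * \<delta> powr (- sum \<gamma> UNIV) < 1"
      by - (drule eventually_happens'[OF trivial_limit_at_right_real], elim exE conjE, rule that)
    have "finite (\<Lambda> // (chain_step \<Lambda> \<delta>)\<^sup>*)"
      using components_of_cylinder_le(1)[OF \<delta>(1) C(2)[OF \<delta>(1,2)], of "[]"] by (simp add: image_def)
    moreover have "\<Lambda> // (chain_step \<Lambda> \<delta>)\<^sup>* \<noteq> {}" using sponge_nonempty by (simp add: quotient_def)
    ultimately have "1 \<le> num_components \<Lambda> \<delta>" unfolding num_components_def by (simp add: Suc_leI card_gt_0_iff)
    then show False using bound[OF \<delta>(1,2), of "[]"] \<delta>(3) by (simp add: image_def)
  qed
  then show ?thesis using that \<gamma>(2) C(1) bound by blast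
qed

end

theorem theorem1p3:
  fixes n :: "'n::{finite,linorder} \<Rightarrow> nat"
    and r t :: "'n \<Rightarrow> nat \<Rightarrow> real"
    and D :: "('n \<Rightarrow> nat) set"
    and \<Lambda> :: "(real, 'n) vec set"
    and \<mu> :: "(real, 'n) vec measure"
  assumes "lalley_gatzouras_sponge n r t D \<Lambda>"
    and "non_degenerated \<Lambda>"
    and "canonical_bernoulli_measure r t D \<mu>"
    and "\<not> maximal_power_law \<Lambda>"
  shows "\<exists>chi. 0 < chi \<and> chi < box_dim \<Lambda> \<and>
           (\<exists>M>0. \<forall>R\<in>cylinders r t D \<Lambda>. \<forall>\<^sub>F \<delta> in at_right 0.
              real (num_components R \<delta>) \<le> M * (measure \<mu> R * \<delta> powr (- chi)))"
proof -
  interpret sponge n r t D \<Lambda> by unfold_locales fact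
  obtain \<beta> where \<mu>: "prob_space \<mu>" "sets \<mu> = sets borel" and "canonical_exponents r D \<beta>"
    and inv: "\<And>B. B \<in> sets borel \<Longrightarrow>
      measure \<mu> B = (\<Sum>a\<in>D. (\<Prod>k\<in>UNIV. r k (a k) powr \<beta> k) * measure \<mu> (diag_map r t a -` B))"
    using assms(3) unfolding canonical_bernoulli_measure_def by (elim exE conjE) (rule that; simp)
  then have \<beta>: "weight_sum \<beta> D i = 1" for i
    by (simp add: canonical_exponents_def weight_sum_def digit_weight_def)
  obtain \<theta> C where \<theta>: "0 \<le> \<theta>" "\<theta> < sum \<beta> UNIV" "0 < C"
    and bound: "\<And>\<delta> w. 0 < \<delta> \<Longrightarrow> \<delta> < 1 \<Longrightarrow> set w \<subseteq> D \<Longrightarrow>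
      real (num_components (word_map w ` \<Lambda>) \<delta>) \<le> C * \<delta> powr (- \<theta>)"
    using components_of_cylinders_bound[OF assms(2) \<beta> assms(4)] by blast
  \<comment> \<open>An exponent strictly above \<open>\<theta>\<close>, so that the constant \<open>C\<close> and the factor \<open>measure \<mu> R\<close> are absorbed.\<close>
  define chi where "chi = (\<theta> + sum \<beta> UNIV) / 2"
  have chi: "0 < chi" "chi < sum \<beta> UNIV" "\<theta> < chi" using \<theta> by (auto simp: chi_def)
  have "\<forall>\<^sub>F \<delta> in at_right 0. real (num_components R \<delta>) \<le> 1 * (measure \<mu> R * \<delta> powr (- chi))"
    if R: "R \<in> cylinders r t D \<Lambda>" for R
  proof -
    obtain w where w: "set w \<subseteq> D" "R = word_map w ` \<Lambda>" using cylindersE[OF R] .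
    have "0 < measure \<mu> R"
      unfolding w(2)
      by (rule measure_cylinder_pos[OF \<mu> digit_weight_pos[where \<gamma> = \<beta> and A = UNIV] _ w(1)])
        (simp_all add: inv digit_weight_def)
    moreover have "((\<lambda>\<delta>. C * \<delta> powr (chi - \<theta>)) \<longlongrightarrow> 0) (at_right 0)"
      using chi(3) by (intro tendsto_mult_powr_right_zero) simp
    ultimately have "\<forall>\<^sub>F \<delta> in at_right 0. C * \<delta> powr (chi - \<theta>) < measure \<mu> R"
      by (auto intro: order_tendstoD(2))
    from eventually_conj[OF eventually_small[OF zero_less_one] this] show ?thesis
    proof (rule eventually_mono)
      fix \<delta> :: real assume \<delta>: "(0 < \<delta> \<and> \<delta> < 1) \<and> C * \<delta> powr (chi - \<theta>) < measure \<mu> R"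
      then have "real (num_components R \<delta>) \<le> C * \<delta> powr (- \<theta>)" using bound w by auto
      also have "\<delta> powr (- \<theta>) = \<delta> powr (chi - \<theta>) * \<delta> powr (- chi)" by (simp flip: powr_add)
      also have "C * \<dots> \<le> measure \<mu> R * \<delta> powr (- chi)"
        using \<delta> by (simp add: mult_right_mono flip: mult.assoc)
      finally show "real (num_components R \<delta>) \<le> 1 * (measure \<mu> R * \<delta> powr (- chi))" by simp
    qed
  qed
  then show ?thesis
    using chi box_dim_sponge[OF assms(2) \<beta>] by (intro exI[of _ chi] conjI exI[of _ 1]) auto
qed

end
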